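(* Consider, for $3\le n\le 8$, the family of $n$-fold cyclic alternating sine--cosine velocity fields $\boldsymbol v^0(\cdot,\boldsymbol\xi)$, $\boldsymbol\xi\in\mathbb R^n$, defined in the context. (a) For $n=3$ and $n=4$ there exist phase vectors $\boldsymbol\xi\in\mathbb R^n$ for which $\boldsymbol v^0\not\equiv 0$ and the pressure-integrability condition holds. (b) For $n=5$ and $n=7$, every real phase vector $\boldsymbol\xi\in\mathbb R^n$ satisfying the reduction condition gives $\boldsymbol v^0\equiv \boldsymbol 0$. (c) For $n=6$ and $n=8$, the symmetric phase vector $\boldsymbol\xi=(-\tfrac{\pi}{4},\tfrac{\pi}{4},\dots,\tfrac{\pi}{4})$ satisfies the reduction condition but fails the pressure-integrability condition.
   Context: Fix $\alpha>0$, $v_r>0$. For an integer $m$ put $\langle m\rangle=((m-1)\bmod n)+1\in\{1,\dots,n\}$. For $\boldsymbol x\in\mathbb R^n$, $\boldsymbol\xi=(\xi_1,\dots,\xi_n)\in\mathbb R^n$ and $i=1,\dots,n$ let $$\mathcal T1_i^0=\prod_{k=1}^{n}\tau_k\big(\alpha x_{\langle i+k-1\rangle}+\xi_k\big),\qquad \tau_k=\sin \text{ for } k \text{ odd},\ \tau_k=\cos\text{ for } k\text{ even},$$ $$\mathcal T2_i^0=\sin(\alpha x_{\langle i\rangle}+\xi_2)\ \prod_{k=2}^{n-1}\sigma_k\big(\alpha x_{\langle i+k-1\rangle}+\xi_{k+1}\big)\ \cos(\alpha x_{\langle i+n-1\rangle}+\xi_1),\qquad \sigma_k=\cos\text{ for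 }k\text{ odd},\ \sigma_k=\sin\text{ for }k\text{ even},$$ and $v_i^0=v_r(\mathcal T1_i^0-\mathcal T2_i^0)$, $\boldsymbol v^0=(v_1^0,\dots,v_n^0)$. The convective field is $g_i^0=\sum_{j=1}^n v_j^0\,\partial v_i^0/\partial x_j$. Let $\mathcal V_i^0$ be the $x_i$-independent part of $g_i^0$, i.e. the sum of all Fourier modes of $g_i^0$ whose wavevector $\boldsymbol k$ has $k_i=0$ (equivalently, the average of $g_i^0$ over $x_i\in[0,2\pi/\alpha]$). The reduction condition: $\mathcal V_i^0\equiv 0$ (as a function of $\boldsymbol x$) for all $i=1,\dots,n$. The pressure-integrability condition: $\partial g_i^0/\partial x_j=\partial g_j^0/\partial x_i$ identically in $\boldsymbol x$ for all $i,j$. *)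

theory Defs
  imports "HOL-Analysis.Analysis"
begin

text \<open>
  Points \<open>x\<close> and phase vectors \<open>\<xi>\<close> of \<open>n\<close>-dimensional space are functions \<open>nat \<Rightarrow> real\<close> of which only
  the coordinates \<open>1, \<dots>, n\<close> are ever read; quantifying over all such functions therefore amounts
  to quantifying over all \<open>n\<close>-vectors. (The dimension is a number and not a type because the
  coordinates are indexed cyclically and the formulas depend on the parity of the position.)
\<close>

definition cyc :: "nat \<Rightarrow> int \<Rightarrow> nat" where
  "cyc n m = nat ((m - 1) mod int n + 1)"

definition tau :: "nat \<Rightarrow> real \<Rightarrow> real" where
  "tau k = (if odd k then sin else cos)"

definition sigma :: "nat \<Rightarrow> real \<Rightarrow> real" where
  "sigma k = (if odd k then cos else sin)"

definition T1 :: "nat \<Rightarrow> real \<Rightarrow> (nat \<Rightarrow> real) \<Rightarrow> nat \<Rightarrow> (nat \<Rightarrow> real) \<Rightarrow> real" where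
  "T1 n \<alpha> \<xi> i x = (\<Prod>k = 1..n. tau k (\<alpha> * x (cyc n (int i + int k - 1)) + \<xi> k))"

definition T2 :: "nat \<Rightarrow> real \<Rightarrow> (nat \<Rightarrow> real) \<Rightarrow> nat \<Rightarrow> (nat \<Rightarrow> real) \<Rightarrow> real" where
  "T2 n \<alpha> \<xi> i x =
     sin (\<alpha> * x (cyc n (int i)) + \<xi> 2)
     * (\<Prod>k = 2..n - 1. sigma k (\<alpha> * x (cyc n (int i + int k - 1)) + \<xi> (k + 1)))
     * cos (\<alpha> * x (cyc n (int i + int n - 1)) + \<xi> 1)"

definition vel :: "nat \<Rightarrow> real \<Rightarrow> real \<Rightarrow> (nat \<Rightarrow> real) \<Rightarrow> nat \<Rightarrow> (nat \<Rightarrow> real) \<Rightarrow> real" where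
  "vel n \<alpha> vr \<xi> i x = vr * (T1 n \<alpha> \<xi> i x - T2 n \<alpha> \<xi> i x)"

definition pderivative :: "nat \<Rightarrow> ((nat \<Rightarrow> real) \<Rightarrow> real) \<Rightarrow> (nat \<Rightarrow> real) \<Rightarrow> real" where
  "pderivative j f x = deriv (\<lambda>t. f (x(j := t))) (x j)"

definition conv :: "nat \<Rightarrow> real \<Rightarrow> real \<Rightarrow> (nat \<Rightarrow> real) \<Rightarrow> nat \<Rightarrow> (nat \<Rightarrow> real) \<Rightarrow> real" where
  "conv n \<alpha> vr \<xi> i x =
     (\<Sum>j = 1..n. vel n \<alpha> vr \<xi> j x * pderivative j (vel n \<alpha> vr \<xi> i) x)"

text \<open>
  The \<open>x\<^sub>i\<close>-independent part of the convective field: the part made up of the Fourier modes whose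
  wavevector has vanishing \<open>i\<close>-th component, obtained as the mean over one period in \<open>x\<^sub>i\<close>.
\<close>

definition indep_part :: "nat \<Rightarrow> real \<Rightarrow> real \<Rightarrow> (nat \<Rightarrow> real) \<Rightarrow> nat \<Rightarrow> (nat \<Rightarrow> real) \<Rightarrow> real" where
  "indep_part n \<alpha> vr \<xi> i x =
     \<alpha> / (2 * pi) * integral {0..2 * pi / \<alpha>} (\<lambda>t. conv n \<alpha> vr \<xi> i (x(i := t)))"

definition vel_vanishes :: "nat \<Rightarrow> real \<Rightarrow> real \<Rightarrow> (nat \<Rightarrow> real) \<Rightarrow> bool" where
  "vel_vanishes n \<alpha> vr \<xi> \<longleftrightarrow> (\<forall>i\<in>{1..n}. \<forall>x. vel n \<alpha> vr \<xi> i x = 0)"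

definition reduction_condition :: "nat \<Rightarrow> real \<Rightarrow> real \<Rightarrow> (nat \<Rightarrow> real) \<Rightarrow> bool" where
  "reduction_condition n \<alpha> vr \<xi> \<longleftrightarrow> (\<forall>i\<in>{1..n}. \<forall>x. indep_part n \<alpha> vr \<xi> i x = 0)"

definition pressure_integrable :: "nat \<Rightarrow> real \<Rightarrow> real \<Rightarrow> (nat \<Rightarrow> real) \<Rightarrow> bool" where
  "pressure_integrable n \<alpha> vr \<xi> \<longleftrightarrow>
     (\<forall>i\<in>{1..n}. \<forall>j\<in>{1..n}. \<forall>x.
        pderivative j (conv n \<alpha> vr \<xi> i) x = pderivative i (conv n \<alpha> vr \<xi> j) x)"

definition sym_phase :: "nat \<Rightarrow> real" where
  "sym_phase k = (if k = 1 then - pi / 4 else pi / 4)"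

end

theory Submission
  imports Defs
begin

text \<open>
  Re-index the phases so that offset 0 carries a sine and all other offsets carry cosines
  (\<open>phase\<close>). Then \<open>T1\<close> is a product wave with phases \<open>e 0, e 1, \<dots>\<close>, and \<open>T2\<close> is the same product
  with the phases moved on by one offset, whatever the parity of \<open>n\<close>. So the velocity is the
  difference of a wave and its shift, and it is zero as soon as all phases agree modulo \<open>\<pi>\<close>.

  Each component is a sinusoid \<open>A cos t + B sin t\<close> in each coordinate. Hence a derivative is a
  translation by a quarter period, and the mean of a product of two sinusoids is the mean of its
  values at two points a quarter period apart. Both conditions of the theorem turn into algebraic
  identities between values of the velocity at translated points (\<open>reduction_iff\<close>,
  \<open>pressure_integrable_iff\<close>).

  For \<open>n = 3\<close> the phases \<open>0, 2\<pi>/3, -2\<pi>/3\<close> make the curl of the velocity proportional to the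
  velocity, and the convective field is then the gradient of half the squared speed. For \<open>n = 4\<close>
  the symmetric phases work by a polynomial identity in the sines and cosines. In every even
  dimension the symmetric phases alternate between two values, and the terms of the reduction
  condition cancel one position at a time (\<open>alternating_balance\<close>); for \<open>n = 6, 8\<close> two mixed
  derivatives of the convective field differ at a point where only one component of the velocity
  is nonzero.

  The main work is the vanishing for \<open>n = 5, 7\<close>. The reduction condition at one component says that
  a signed sum of products of sines vanishes at all points (\<open>mean_convection_eq_balance\<close>). A factor
  vanishes when a coordinate and a phase have the same direction modulo \<open>\<pi>\<close>. Placing two or three
  coordinates at such zeros kills nearly all products, and what is left forces coincidences between
  phases. Call \<open>u\<close> a jump if \<open>e u\<close> and \<open>e (u + 1)\<close> differ modulo \<open>\<pi>\<close>. If 0 is a jump and \<open>n \<ge> 5\<close> is prime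
  then every position is one (\<open>jump_everywhere\<close>); if 0 is not a jump, a position without jump is
  orthogonal to \<open>e 0\<close> or lies in a symmetric pair of positions where the phase is that of \<open>e 0\<close>
  (\<open>non_jump_position\<close>). Together with rules for pairs of jumps this leaves, besides one
  exceptional shape, only patterns of two orthogonal directions, and each of these is refuted by
  a point at which a single product survives (\<open>two_valued_isolated\<close>).
\<close>

section \<open>Phases as directions\<close>

text \<open>
  A phase matters only modulo \<open>\<pi>\<close>, that is, as an undirected line in the plane. Doubling the angle
  turns lines into points of the unit circle and orthogonality of lines into negation, so that
  vanishing of a sine or a cosine becomes an equation.
\<close>

definition dir :: "real \<Rightarrow> complex" where
  "dir x = cis (2 * x)"

lemma dir_diff: "dir x = dir y \<longleftrightarrow> sin (x - y) = 0"
proof -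
  have "dir x = dir y \<longleftrightarrow> cis (2 * (x - y)) = 1"
    by (simp add: dir_def right_diff_distrib flip: cis_divide)
  also have "\<dots> \<longleftrightarrow> cos (2 * (x - y)) = 1 \<and> sin (2 * (x - y)) = 0"
    by (auto simp: complex_eq_iff)
  also have "\<dots> \<longleftrightarrow> sin (x - y) = 0"
    unfolding cos_double_sin sin_double by auto
  finally show ?thesis .
qed

lemma dir_add_pi_half [simp]: "dir (x + pi / 2) = - dir x" "dir (pi / 2 + x) = - dir x"
  by (simp_all add: dir_def distrib_left flip: cis_mult)

lemma dir_orth: "dir x = - dir y \<longleftrightarrow> cos (x - y) = 0"
proof -
  have "dir x = - dir y \<longleftrightarrow> sin (x - (y + pi / 2)) = 0"
    by (metis dir_add_pi_half(1) dir_diff)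
  also have "sin (x - (y + pi / 2)) = - cos (x - y)"
    by (simp add: sin_diff cos_diff sin_add cos_add)
  finally show ?thesis by simp
qed

lemma dir_nonzero [simp]: "dir x \<noteq> 0"
  by (simp add: dir_def)

lemma dir_neq_minus [simp]: "dir x \<noteq> - dir x" "- dir x \<noteq> dir x"
  by (simp_all add: eq_neg_iff_add_eq_0 neg_eq_iff_add_eq_0)

lemma exists_generic_dir:
  assumes "finite F"
  shows "\<exists>\<gamma>. dir \<gamma> \<notin> F"
proof (rule ccontr)
  assume "\<nexists>\<gamma>. dir \<gamma> \<notin> F"
  then have "dir ` {0<..<1} \<subseteq> F" by blast
  moreover have "inj_on dir {0<..<1}"
  proof (rule inj_onI)
    fix x y :: real
    assume "x \<in> {0<..<1}" "y \<in> {0<..<1}" "dir x = dir y"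
    then have "sin (x - y) = 0" "\<bar>x - y\<bar> < pi"
      using pi_gt3 by (auto simp: dir_diff)
    then have "x - y = 0" using sin_eq_0_pi[of "x - y"] by argo
    then show "x = y" by simp
  qed
  ultimately have "finite {0<..<1::real}"
    using assms finite_imageD finite_subset by blast
  then show False using infinite_Ioo[of 0 "1::real"] by simp
qed

text \<open>
  The difference of the two sides is a single sinusoid; it cannot have two zeros of different
  direction unless it is zero, and two sinusoids with different zeros are independent.
\<close>

lemma sinusoids_independent:
  assumes eq: "\<And>\<gamma>. \<gamma> \<in> {\<gamma>1, \<gamma>2} \<Longrightarrow> L * sin (\<gamma> - p) = R * sin (\<gamma> - q)"
    and "dir \<gamma>1 \<noteq> dir \<gamma>2" and "dir p \<noteq> dir q"
  shows "L = 0" "R = 0"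
proof -
  define a where "a = L * cos p - R * cos q"
  define b where "b = L * sin p - R * sin q"
  have e: "sin \<gamma> * a = cos \<gamma> * b" if "\<gamma> \<in> {\<gamma>1, \<gamma>2}" for \<gamma>
    using eq[OF that] by (simp add: a_def b_def sin_diff algebra_simps)
  have d: "sin (\<gamma>1 - \<gamma>2) \<noteq> 0" "sin (p - q) \<noteq> 0"
    using assms by (simp_all add: dir_diff)
  have "sin (\<gamma>1 - \<gamma>2) * a = cos \<gamma>2 * (sin \<gamma>1 * a) - cos \<gamma>1 * (sin \<gamma>2 * a)"
    by (simp add: sin_diff algebra_simps)
  also have "\<dots> = 0" using e by simp
  finally have a: "a = 0" using d by simp
  have "sin (\<gamma>1 - \<gamma>2) * b = sin \<gamma>1 * (cos \<gamma>2 * b) - sin \<gamma>2 * (cos \<gamma>1 * b)"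
    by (simp add: sin_diff algebra_simps)
  also have "\<dots> = sin \<gamma>1 * (sin \<gamma>2 * a) - sin \<gamma>2 * (sin \<gamma>1 * a)"
    using e[of \<gamma>1] e[of \<gamma>2] by simp
  also have "\<dots> = 0" by simp
  finally have b: "b = 0" using d by simp
  have "L * sin (p - q) = cos q * b - sin q * a" "R * sin (p - q) = cos p * b - sin p * a"
    by (simp_all add: a_def b_def sin_diff algebra_simps)
  then show "L = 0" "R = 0" using a b d by simp_all
qed

section \<open>The velocity field as a difference of two product waves\<close>

lemma periodic_mod:
  fixes e :: "int \<Rightarrow> 'a"
  assumes "\<And>m. e (m + int n) = e m"
  shows "e (m mod int n) = e m"
proof -
  have *: "e (v + int k * int n) = e v" for v k
  proof (induction k)
    case (Suc k)
    have "e (v + int (Suc k) * int n) = e (v + int k * int n + int n)" by (simp add: algebra_simps)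
    then show ?case using Suc assms by simp
  qed simp
  show ?thesis
  proof (cases "m div int n \<ge> 0")
    case True
    then show ?thesis using *[of "m mod int n" "nat (m div int n)"] by (simp add: algebra_simps)
  next
    case False
    then show ?thesis using *[of m "nat (- (m div int n))"] by (simp add: minus_mult_div_eq_mod algebra_simps)
  qed
qed

text \<open>
  At an even offset \<open>d > 0\<close> the factor of \<open>T1\<close> is a sine, which is a cosine of the phase lowered by
  \<open>\<pi> / 2\<close>; offset 0 is left a sine. With this choice the factors of \<open>T2\<close> are those of \<open>T1\<close> with
  every phase replaced by the next one.
\<close>

definition phase :: "nat \<Rightarrow> (nat \<Rightarrow> real) \<Rightarrow> int \<Rightarrow> real" where
  "phase n \<xi> m = \<xi> (nat (m mod int n) + 1)
     - (if m mod int n \<noteq> 0 \<and> even (m mod int n) then pi / 2 else 0)"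

lemma phase_period: "phase n \<xi> (m + int n) = phase n \<xi> m"
  by (simp add: phase_def)

definition wave :: "nat \<Rightarrow> (int \<Rightarrow> real) \<Rightarrow> (nat \<Rightarrow> real) \<Rightarrow> nat \<Rightarrow> real" where
  "wave n e y i = sin (y i + e 0) * (\<Prod>u\<in>{1..n} - {i}. cos (y u + e (int u - int i)))"

definition vfield :: "nat \<Rightarrow> (int \<Rightarrow> real) \<Rightarrow> (nat \<Rightarrow> real) \<Rightarrow> nat \<Rightarrow> real" where
  "vfield n e y i = wave n e y i - wave n (\<lambda>m. e (m + 1)) y i"

lemma cyc_range: "n > 0 \<Longrightarrow> cyc n m \<in> {1..n}"
proof -
  assume "n > 0"
  then have "0 \<le> (m - 1) mod int n" "(m - 1) mod int n < int n" by simp_all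
  then show ?thesis by (auto simp: cyc_def nat_le_iff)
qed

lemma int_cyc: "n > 0 \<Longrightarrow> int (cyc n m) = (m - 1) mod int n + 1"
  by (simp add: cyc_def)

lemma cyc_mod: "n > 0 \<Longrightarrow> int (cyc n m) mod int n = m mod int n"
  by (simp add: int_cyc mod_add_left_eq)

lemma cyc_id: "i \<in> {1..n} \<Longrightarrow> cyc n (int i) = i"
  by (auto simp: cyc_def of_nat_diff mod_pos_pos_trivial)

lemma cyc_eq_iff:
  assumes "n > 0"
  shows "cyc n a = cyc n b \<longleftrightarrow> a mod int n = b mod int n"
proof
  assume "cyc n a = cyc n b"
  then show "a mod int n = b mod int n" using cyc_mod[OF assms] by metis
next
  assume "a mod int n = b mod int n"
  then have "(a - 1) mod int n = (b - 1) mod int n" by (metis mod_diff_left_eq)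
  then show "cyc n a = cyc n b" by (simp add: cyc_def)
qed

lemma cyc_offsets_bij:
  assumes "i \<in> {1..n}"
  shows "bij_betw (\<lambda>d. cyc n (int i + d)) {1..<int n} ({1..n} - {i})"
proof -
  have n: "n > 0" using assms by auto
  have inj: "inj_on (\<lambda>d. cyc n (int i + d)) {0..<int n}"
  proof (rule inj_onI)
    fix a b assume "a \<in> {0..<int n}" "b \<in> {0..<int n}" "cyc n (int i + a) = cyc n (int i + b)"
    then have "(int i + a) mod int n = (int i + b) mod int n" "a mod int n = a" "b mod int n = b"
      by (simp_all add: cyc_eq_iff[OF n])
    then show "a = b" by (metis add_diff_cancel_left' mod_diff_left_eq)
  qed
  have "(\<lambda>d. cyc n (int i + d)) ` {0..<int n} = {1..n}"
  proof (rule card_subset_eq)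
    show "(\<lambda>d. cyc n (int i + d)) ` {0..<int n} \<subseteq> {1..n}" using cyc_range[OF n] by blast
    show "card ((\<lambda>d. cyc n (int i + d)) ` {0..<int n}) = card {1..n}"
      using inj by (simp add: card_image)
  qed simp
  then have "bij_betw (\<lambda>d. cyc n (int i + d)) {0..<int n} {1..n}"
    using inj by (simp add: bij_betw_def)
  then have "bij_betw (\<lambda>d. cyc n (int i + d)) ({0..<int n} - {0}) ({1..n} - {cyc n (int i + 0)})"
    using n cyc_range[OF n] by (intro bij_betw_DiffI) (auto simp: bij_betw_def)
  moreover have "{0..<int n} - {0} = {1..<int n}" by auto
  ultimately show ?thesis using cyc_id[OF assms] by simp
qed

lemma prod_offsets:
  fixes f :: "nat \<Rightarrow> int \<Rightarrow> real"
  assumes "i \<in> {1..n}" and f: "\<And>u d. f u (d mod int n) = f u d"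
  shows "(\<Prod>k\<in>{2..n}. f (cyc n (int i + int k - 1)) (int k - 1))
       = (\<Prod>u\<in>{1..n} - {i}. f u (int u - int i))"
proof -
  have n: "n > 0" using assms by auto
  have "bij_betw (\<lambda>k. int k - 1) {2..n} {1..<int n}"
    by (rule bij_betwI[where g = "\<lambda>d. nat (d + 1)"]) auto
  then have "bij_betw ((\<lambda>d. cyc n (int i + d)) \<circ> (\<lambda>k. int k - 1)) {2..n} ({1..n} - {i})"
    using cyc_offsets_bij[OF assms(1)] by (rule bij_betw_trans)
  then have b: "bij_betw (\<lambda>k. cyc n (int i + (int k - 1))) {2..n} ({1..n} - {i})"
    by (simp add: o_def)
  have "f (cyc n (int i + (int k - 1))) (int k - 1)
      = f (cyc n (int i + (int k - 1))) (int (cyc n (int i + (int k - 1))) - int i)" for k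
  proof -
    have "(int (cyc n (int i + (int k - 1))) - int i) mod int n = (int k - 1) mod int n"
      using cyc_mod[OF n, of "int i + (int k - 1)"]
      by (metis add_diff_cancel_left' mod_diff_left_eq)
    then show ?thesis by (metis f)
  qed
  then show ?thesis
    using prod.reindex_bij_betw[OF b, of "\<lambda>u. f u (int u - int i)"]
    by (simp add: add_diff_eq)
qed

lemma T1_eq_wave:
  assumes "i \<in> {1..n}"
  shows "T1 n \<alpha> \<xi> i x = wave n (phase n \<xi>) (\<lambda>u. \<alpha> * x u) i"
proof -
  have split: "{1..n} = insert 1 {2..n}" using assms by auto
  have "tau k (\<alpha> * x u + \<xi> k) = cos (\<alpha> * x u + phase n \<xi> (int k - 1))" if "k \<in> {2..n}" for k u
  proof -
    have "(int k - 1) mod int n = int k - 1" "nat (int k - 1) + 1 = k" using that by auto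
    then show ?thesis
      using that sin_cos_eq[of "\<alpha> * x u + \<xi> k"] cos_minus[of "pi / 2 - (\<alpha> * x u + \<xi> k)"]
      by (auto simp: tau_def phase_def algebra_simps)
  qed
  then have "(\<Prod>k = 2..n. tau k (\<alpha> * x (cyc n (int i + int k - 1)) + \<xi> k))
     = (\<Prod>k = 2..n. cos (\<alpha> * x (cyc n (int i + int k - 1)) + phase n \<xi> (int k - 1)))"
    by simp
  also have "\<dots> = (\<Prod>u\<in>{1..n} - {i}. cos (\<alpha> * x u + phase n \<xi> (int u - int i)))"
    by (rule prod_offsets[OF assms, where f = "\<lambda>u d. cos (\<alpha> * x u + phase n \<xi> d)"])
       (simp add: phase_def)
  finally show ?thesis
    using cyc_id[OF assms] unfolding T1_def wave_def split by (simp add: tau_def phase_def)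
qed

lemma T2_eq_wave:
  assumes "i \<in> {1..n}" "n \<ge> 2"
  shows "T2 n \<alpha> \<xi> i x = wave n (\<lambda>m. phase n \<xi> (m + 1)) (\<lambda>u. \<alpha> * x u) i"
proof -
  define f where "f u d = cos (\<alpha> * x u + phase n \<xi> (d + 1))" for u d
  have "sigma k (\<alpha> * x u + \<xi> (k + 1)) = f u (int k - 1)" if "k \<in> {2..n - 1}" for k u
  proof -
    have "int k mod int n = int k" using that by auto
    then show ?thesis
      using that sin_cos_eq[of "\<alpha> * x u + \<xi> (k + 1)"] cos_minus[of "pi / 2 - (\<alpha> * x u + \<xi> (k + 1))"]
      by (auto simp: f_def sigma_def phase_def algebra_simps)
  qed
  then have "(\<Prod>k = 2..n - 1. sigma k (\<alpha> * x (cyc n (int i + int k - 1)) + \<xi> (k + 1)))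
     = (\<Prod>k = 2..n - 1. f (cyc n (int i + int k - 1)) (int k - 1))"
    by simp
  moreover have "cos (\<alpha> * x (cyc n (int i + int n - 1)) + \<xi> 1) = f (cyc n (int i + int n - 1)) (int n - 1)"
    by (simp add: f_def phase_def)
  moreover have "{2..n} = insert n {2..n - 1}" "n \<notin> {2..n - 1}" using assms by auto
  ultimately have "(\<Prod>k = 2..n - 1. sigma k (\<alpha> * x (cyc n (int i + int k - 1)) + \<xi> (k + 1)))
       * cos (\<alpha> * x (cyc n (int i + int n - 1)) + \<xi> 1)
     = (\<Prod>k = 2..n. f (cyc n (int i + int k - 1)) (int k - 1))"
    by simp
  also have "\<dots> = (\<Prod>u\<in>{1..n} - {i}. f u (int u - int i))"
    by (rule prod_offsets[OF assms(1)]) (simp add: f_def phase_def mod_add_left_eq)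
  finally have "T2 n \<alpha> \<xi> i x = sin (\<alpha> * x i + \<xi> 2) * (\<Prod>u\<in>{1..n} - {i}. f u (int u - int i))"
    using cyc_id[OF assms(1)] by (simp add: T2_def)
  moreover have "phase n \<xi> 1 = \<xi> 2"
    using assms(2) by (cases "n = 2") (auto simp: phase_def numeral_2_eq_2)
  ultimately show ?thesis by (simp add: wave_def f_def)
qed

lemma vel_eq_vfield:
  assumes "i \<in> {1..n}" "n \<ge> 2"
  shows "vel n \<alpha> vr \<xi> i x = vr * vfield n (phase n \<xi>) (\<lambda>u. \<alpha> * x u) i"
  using assms by (simp add: vel_def vfield_def T1_eq_wave T2_eq_wave)

section \<open>Derivatives and means by quarter periods\<close>

definition harmonic :: "(real \<Rightarrow> real) \<Rightarrow> bool" where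
  "harmonic f \<longleftrightarrow> (\<exists>A B. \<forall>t. f t = A * cos t + B * sin t)"

lemma harmonic_translate: "harmonic f \<Longrightarrow> harmonic (\<lambda>t. f (t + s))"
proof -
  assume "harmonic f"
  then obtain A B where f: "\<And>t. f t = A * cos t + B * sin t" unfolding harmonic_def by blast
  show ?thesis unfolding harmonic_def
    by (rule exI[of _ "A * cos s + B * sin s"], rule exI[of _ "B * cos s - A * sin s"])
       (simp add: f sin_add cos_add algebra_simps)
qed

lemma harmonic_sin: "harmonic (\<lambda>t. sin (t + s) * K)"
  unfolding harmonic_def by (rule exI[of _ "sin s * K"], rule exI[of _ "cos s * K"]) (simp add: sin_add algebra_simps)

lemma harmonic_cos: "harmonic (\<lambda>t. cos (t + s) * K)"
  unfolding harmonic_def by (rule exI[of _ "cos s * K"], rule exI[of _ "- sin s * K"]) (simp add: cos_add algebra_simps)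

lemma harmonic_diff: "harmonic f \<Longrightarrow> harmonic g \<Longrightarrow> harmonic (\<lambda>t. f t - g t)"
  unfolding harmonic_def
proof (elim exE)
  fix A B C D
  assume "\<forall>t. f t = A * cos t + B * sin t" "\<forall>t. g t = C * cos t + D * sin t"
  then show "\<exists>A B. \<forall>t. f t - g t = A * cos t + B * sin t"
    by (intro exI[of _ "A - C"] exI[of _ "B - D"]) (simp add: algebra_simps)
qed

lemma harmonic_deriv:
  assumes "harmonic f"
  shows "(f has_real_derivative f (t + pi / 2)) (at t)"
proof -
  obtain A B where f: "f = (\<lambda>t. A * cos t + B * sin t)" using assms unfolding harmonic_def by blast
  show ?thesis unfolding f by (auto intro!: derivative_eq_intros simp: sin_add cos_add)
qed

lemma harmonic_antiperiodic:
  assumes "harmonic f"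
  shows "f (t + pi) = - f t"
  using assms by (auto simp: harmonic_def)

text \<open>
  The product has frequencies 0 and 2 only, and the part of frequency 2 changes sign over a
  quarter period. Two samples therefore determine the mean.
\<close>

lemma harmonic_product_integral:
  assumes "harmonic f" "harmonic g" "\<alpha> > 0"
  shows "((\<lambda>t. f (\<alpha> * t) * g (\<alpha> * t)) has_integral
     pi / \<alpha> * (f s * g s + f (s + pi / 2) * g (s + pi / 2))) {0..2 * pi / \<alpha>}"
proof -
  obtain A B where f: "f = (\<lambda>t. A * cos t + B * sin t)" using assms unfolding harmonic_def by blast
  obtain C D where g: "g = (\<lambda>t. C * cos t + D * sin t)" using assms unfolding harmonic_def by blast
  define F where "F t = (A * C + B * D) * t / 2
      + ((A * C - B * D) * sin (\<alpha> * t) * cos (\<alpha> * t) + (A * D + B * C) * (sin (\<alpha> * t))\<^sup>2) / (2 * \<alpha>)" for t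
  have "((\<lambda>t. f (\<alpha> * t) * g (\<alpha> * t)) has_integral (F (2 * pi / \<alpha>) - F 0)) {0..2 * pi / \<alpha>}"
  proof (rule fundamental_theorem_of_calculus)
    fix t
    have "(F has_real_derivative f (\<alpha> * t) * g (\<alpha> * t)) (at t within {0..2 * pi / \<alpha>})"
      unfolding F_def f g using \<open>\<alpha> > 0\<close>
      apply (auto intro!: derivative_eq_intros simp: field_simps power2_eq_square)
      using sin_cos_squared_add[of "\<alpha> * t"] by algebra
    then show "(F has_vector_derivative f (\<alpha> * t) * g (\<alpha> * t)) (at t within {0..2 * pi / \<alpha>})"
      by (simp add: has_real_derivative_iff_has_vector_derivative)
  qed (use \<open>\<alpha> > 0\<close> in simp)
  moreover have "f s * g s + f (s + pi / 2) * g (s + pi / 2) = A * C + B * D"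
  proof -
    have "(sin s)\<^sup>2 + (cos s)\<^sup>2 = 1" by simp
    then have "(A * cos s + B * sin s) * (C * cos s + D * sin s)
        + (B * cos s - A * sin s) * (D * cos s - C * sin s) = A * C + B * D" by algebra
    then show ?thesis by (simp add: f g sin_add cos_add)
  qed
  moreover have "F (2 * pi / \<alpha>) - F 0 = pi / \<alpha> * (A * C + B * D)"
    using \<open>\<alpha> > 0\<close> by (simp add: F_def field_simps)
  ultimately show ?thesis by simp
qed

definition advance :: "nat \<Rightarrow> (nat \<Rightarrow> real) \<Rightarrow> nat \<Rightarrow> real" where
  "advance j y = y(j := y j + pi / 2)"

lemma wave_harmonic:
  assumes "j \<in> {1..n}"
  shows "harmonic (\<lambda>t. wave n e (y(j := t)) i)"
proof (cases "j = i")
  case True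
  have "(\<lambda>t. wave n e (y(j := t)) i)
      = (\<lambda>t. sin (t + e 0) * (\<Prod>u\<in>{1..n} - {i}. cos (y u + e (int u - int i))))"
    using True by (auto simp: wave_def intro!: prod.cong)
  then show ?thesis using harmonic_sin by simp
next
  case False
  let ?K = "sin (y i + e 0) * (\<Prod>u\<in>{1..n} - {i} - {j}. cos (y u + e (int u - int i)))"
  have "wave n e (y(j := t)) i = cos (t + e (int j - int i)) * ?K" for t
  proof -
    have "(\<Prod>u\<in>{1..n} - {i}. cos ((y(j := t)) u + e (int u - int i)))
      = cos (t + e (int j - int i)) * (\<Prod>u\<in>{1..n} - {i} - {j}. cos ((y(j := t)) u + e (int u - int i)))"
      using assms False by (subst prod.remove[of _ j]) auto
    also have "(\<Prod>u\<in>{1..n} - {i} - {j}. cos ((y(j := t)) u + e (int u - int i)))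
      = (\<Prod>u\<in>{1..n} - {i} - {j}. cos (y u + e (int u - int i)))"
      by (rule prod.cong) auto
    finally show ?thesis using False by (simp add: wave_def)
  qed
  then show ?thesis using harmonic_cos[of "e (int j - int i)" ?K] by simp
qed

lemma vfield_harmonic: "j \<in> {1..n} \<Longrightarrow> harmonic (\<lambda>t. vfield n e (y(j := t)) i)"
  unfolding vfield_def by (intro harmonic_diff wave_harmonic)

lemma vfield_advance_harmonic: "j \<in> {1..n} \<Longrightarrow> harmonic (\<lambda>t. vfield n e (advance k (y(j := t))) i)"
proof (cases "j = k")
  case True
  assume "j \<in> {1..n}"
  then have "harmonic (\<lambda>t. vfield n e (y(j := t + pi / 2)) i)"
    by (intro harmonic_translate[OF vfield_harmonic])
  then show ?thesis using True by (simp add: advance_def)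
next
  case False
  assume "j \<in> {1..n}"
  then show ?thesis using vfield_harmonic[of j n e "advance k y"] False by (simp add: advance_def fun_upd_twist)
qed

lemma vfield_advance_advance: "j \<in> {1..n} \<Longrightarrow> vfield n e (advance j (advance j y)) i = - vfield n e y i"
  using harmonic_antiperiodic[OF vfield_harmonic[of j n e y i], of "y j"] by (simp add: advance_def add.commute)

lemma scale_update: "(\<lambda>u. \<alpha> * (x(j := t)) u) = (\<lambda>u. \<alpha> * x u)(j := \<alpha> * t)" for x :: "nat \<Rightarrow> real"
  by auto

lemma pderivative_vel:
  assumes "i \<in> {1..n}" "j \<in> {1..n}" "n \<ge> 2"
  shows "pderivative j (vel n \<alpha> vr \<xi> i) x
       = \<alpha> * vr * vfield n (phase n \<xi>) (advance j (\<lambda>u. \<alpha> * x u)) i"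
proof -
  have "((\<lambda>t. vr * vfield n (phase n \<xi>) ((\<lambda>u. \<alpha> * x u)(j := \<alpha> * t)) i) has_real_derivative
      \<alpha> * vr * vfield n (phase n \<xi>) ((\<lambda>u. \<alpha> * x u)(j := \<alpha> * x j + pi / 2)) i) (at (x j))"
    by (rule derivative_eq_intros DERIV_chain2[OF harmonic_deriv[OF vfield_harmonic[OF assms(2)]]] | simp)+
  then show ?thesis
    by (simp add: pderivative_def vel_eq_vfield[OF assms(1,3)] scale_update DERIV_imp_deriv advance_def
        del: fun_upd_apply)
qed

lemma conv_eq:
  assumes "i \<in> {1..n}" "n \<ge> 2"
  shows "conv n \<alpha> vr \<xi> i x = \<alpha> * vr\<^sup>2 * (\<Sum>j = 1..n. vfield n (phase n \<xi>) (\<lambda>u. \<alpha> * x u) j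
      * vfield n (phase n \<xi>) (advance j (\<lambda>u. \<alpha> * x u)) i)"
  unfolding conv_def sum_distrib_left
  by (rule sum.cong) (use assms in \<open>simp_all add: vel_eq_vfield pderivative_vel power2_eq_square\<close>)

text \<open>
  The product rule for \<open>\<Sum>j. v j * \<partial>j (v i)\<close>, with all derivatives written as quarter-period
  translations; up to a constant this is the \<open>k\<close>-th partial derivative of the \<open>i\<close>-th component of
  the convective field.
\<close>

definition convection_jacobian :: "nat \<Rightarrow> (int \<Rightarrow> real) \<Rightarrow> (nat \<Rightarrow> real) \<Rightarrow> nat \<Rightarrow> nat \<Rightarrow> real" where
  "convection_jacobian n e y i k = (\<Sum>j = 1..n. vfield n e (advance k y) j * vfield n e (advance j y) i
      + vfield n e y j * vfield n e (advance j (advance k y)) i)"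

lemma pderivative_conv:
  assumes "i \<in> {1..n}" "k \<in> {1..n}" "n \<ge> 2"
  shows "pderivative k (conv n \<alpha> vr \<xi> i) x
       = (\<alpha> * vr)\<^sup>2 * convection_jacobian n (phase n \<xi>) (\<lambda>u. \<alpha> * x u) i k"
proof -
  let ?y = "\<lambda>u. \<alpha> * x u" and ?V = "vfield n (phase n \<xi>)"
  have upd: "?y(k := \<alpha> * x k) = ?y" by auto
  have "((\<lambda>t. ?V (?y(k := \<alpha> * t)) j * ?V (advance j (?y(k := \<alpha> * t))) i) has_real_derivative
     \<alpha> * (?V (advance k ?y) j * ?V (advance j ?y) i + ?V ?y j * ?V (advance j (advance k ?y)) i)) (at (x k))" for j
  proof -
    have 1: "((\<lambda>t. ?V (?y(k := \<alpha> * t)) j) has_real_derivative ?V (?y(k := \<alpha> * x k + pi / 2)) j * \<alpha>) (at (x k))"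
      by (rule DERIV_chain2[OF harmonic_deriv[OF vfield_harmonic[OF assms(2)]]])
         (auto intro!: derivative_eq_intros)
    have 2: "((\<lambda>t. ?V (advance j (?y(k := \<alpha> * t))) i) has_real_derivative
        ?V (advance j (?y(k := \<alpha> * x k + pi / 2))) i * \<alpha>) (at (x k))"
      by (rule DERIV_chain2[OF harmonic_deriv[OF vfield_advance_harmonic[OF assms(2)]]])
         (auto intro!: derivative_eq_intros)
    show ?thesis
      using DERIV_mult[OF 1 2] upd by (simp add: advance_def[of k] algebra_simps)
  qed
  then have "((\<lambda>t. \<alpha> * vr\<^sup>2 * (\<Sum>j = 1..n. ?V (?y(k := \<alpha> * t)) j * ?V (advance j (?y(k := \<alpha> * t))) i))
      has_real_derivative \<alpha> * vr\<^sup>2 * (\<Sum>j = 1..n. \<alpha> * (?V (advance k ?y) j * ?V (advance j ?y) i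
         + ?V ?y j * ?V (advance j (advance k ?y)) i))) (at (x k))"
    by (intro DERIV_cmult DERIV_sum)
  then have "pderivative k (conv n \<alpha> vr \<xi> i) x = \<alpha> * vr\<^sup>2 * (\<Sum>j = 1..n. \<alpha> * (?V (advance k ?y) j * ?V (advance j ?y) i
         + ?V ?y j * ?V (advance j (advance k ?y)) i))"
    by (simp add: pderivative_def conv_eq[OF assms(1,3)] scale_update DERIV_imp_deriv
        del: fun_upd_apply)
  then show ?thesis
    by (simp add: convection_jacobian_def sum_distrib_left[symmetric] power2_eq_square)
qed

text \<open>
  The two samples of \<open>\<Sum>j. v j * \<partial>j (v i)\<close> a quarter period apart in coordinate \<open>i\<close>, whose sum is
  twice the mean over that coordinate.
\<close>

definition mean_convection :: "nat \<Rightarrow> (int \<Rightarrow> real) \<Rightarrow> (nat \<Rightarrow> real) \<Rightarrow> nat \<Rightarrow> real" where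
  "mean_convection n e y i = (\<Sum>j = 1..n. vfield n e y j * vfield n e (advance j y) i
      + vfield n e (advance i y) j * vfield n e (advance j (advance i y)) i)"

lemma indep_part_eq:
  assumes "i \<in> {1..n}" "n \<ge> 2" "\<alpha> > 0"
  shows "indep_part n \<alpha> vr \<xi> i x
       = \<alpha> * vr\<^sup>2 / 2 * mean_convection n (phase n \<xi>) (\<lambda>u. \<alpha> * x u) i"
proof -
  let ?y = "\<lambda>u. \<alpha> * x u" and ?V = "vfield n (phase n \<xi>)"
  have upd: "?y(i := \<alpha> * x i) = ?y" by auto
  have "((\<lambda>t. ?V (?y(i := \<alpha> * t)) j * ?V (advance j (?y(i := \<alpha> * t))) i) has_integral
     pi / \<alpha> * (?V ?y j * ?V (advance j ?y) i + ?V (advance i ?y) j * ?V (advance j (advance i ?y)) i))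
     {0..2 * pi / \<alpha>}" for j
    using harmonic_product_integral[OF vfield_harmonic[OF assms(1), of "phase n \<xi>" ?y j]
        vfield_advance_harmonic[OF assms(1), of "phase n \<xi>" j ?y i] assms(3), of "\<alpha> * x i"] upd
    by (simp add: advance_def[of i])
  then have "((\<lambda>t. \<alpha> * vr\<^sup>2 * (\<Sum>j = 1..n. ?V (?y(i := \<alpha> * t)) j * ?V (advance j (?y(i := \<alpha> * t))) i)) has_integral
     \<alpha> * vr\<^sup>2 * (\<Sum>j = 1..n. pi / \<alpha> * (?V ?y j * ?V (advance j ?y) i + ?V (advance i ?y) j * ?V (advance j (advance i ?y)) i)))
     {0..2 * pi / \<alpha>}"
    by (intro has_integral_mult_right has_integral_sum) auto
  note int = integral_unique[OF this]
  have "conv n \<alpha> vr \<xi> i (x(i := t)) = \<alpha> * vr\<^sup>2 * (\<Sum>j = 1..n. ?V (?y(i := \<alpha> * t)) j * ?V (advance j (?y(i := \<alpha> * t))) i)" for t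
    unfolding conv_eq[OF assms(1,2)] scale_update ..
  then have "integral {0..2 * pi / \<alpha>} (\<lambda>t. conv n \<alpha> vr \<xi> i (x(i := t)))
     = \<alpha> * vr\<^sup>2 * (pi / \<alpha> * mean_convection n (phase n \<xi>) ?y i)"
    unfolding mean_convection_def sum_distrib_left using int by (simp only: sum_distrib_left)
  then show ?thesis using \<open>\<alpha> > 0\<close> by (simp add: indep_part_def field_simps power2_eq_square)
qed

lemma exists_scaled:
  fixes y :: "nat \<Rightarrow> real"
  assumes "\<alpha> \<noteq> 0"
  obtains x where "y = (\<lambda>u. \<alpha> * x u)"
  using that[of "\<lambda>u. y u / \<alpha>"] assms by auto

lemma reduction_iff:
  assumes "n \<ge> 2" "\<alpha> > 0" "vr > 0"
  shows "reduction_condition n \<alpha> vr \<xi> \<longleftrightarrow> (\<forall>i\<in>{1..n}. \<forall>y. mean_convection n (phase n \<xi>) y i = 0)"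
  unfolding reduction_condition_def
proof (intro ball_cong refl)
  fix i assume i: "i \<in> {1..n}"
  show "(\<forall>x. indep_part n \<alpha> vr \<xi> i x = 0) \<longleftrightarrow> (\<forall>y. mean_convection n (phase n \<xi>) y i = 0)"
    using indep_part_eq[OF i assms(1,2), of vr \<xi>] assms exists_scaled[of \<alpha>]
    by (smt (verit, ccfv_SIG) divide_eq_0_iff mult_eq_0_iff power_eq_0_iff)
qed

lemma pressure_integrable_iff:
  assumes "n \<ge> 2" "\<alpha> > 0" "vr > 0"
  shows "pressure_integrable n \<alpha> vr \<xi> \<longleftrightarrow>
    (\<forall>i\<in>{1..n}. \<forall>j\<in>{1..n}. \<forall>y. convection_jacobian n (phase n \<xi>) y i j = convection_jacobian n (phase n \<xi>) y j i)"
  unfolding pressure_integrable_def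
proof (intro ball_cong refl)
  fix i j assume ij: "i \<in> {1..n}" "j \<in> {1..n}"
  have "(\<forall>x. convection_jacobian n (phase n \<xi>) (\<lambda>u. \<alpha> * x u) i j = convection_jacobian n (phase n \<xi>) (\<lambda>u. \<alpha> * x u) j i)
    \<longleftrightarrow> (\<forall>y. convection_jacobian n (phase n \<xi>) y i j = convection_jacobian n (phase n \<xi>) y j i)"
    using exists_scaled[of \<alpha>] assms(2) by (metis less_irrefl)
  then show "(\<forall>x. pderivative j (conv n \<alpha> vr \<xi> i) x = pderivative i (conv n \<alpha> vr \<xi> j) x) \<longleftrightarrow>
      (\<forall>y. convection_jacobian n (phase n \<xi>) y i j = convection_jacobian n (phase n \<xi>) y j i)"
    using ij assms by (simp add: pderivative_conv)
qed

lemma vel_vanishes_iff: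
  assumes "n \<ge> 2" "\<alpha> > 0" "vr > 0"
  shows "vel_vanishes n \<alpha> vr \<xi> \<longleftrightarrow> (\<forall>i\<in>{1..n}. \<forall>y. vfield n (phase n \<xi>) y i = 0)"
  unfolding vel_vanishes_def
proof (intro ball_cong refl)
  fix i assume i: "i \<in> {1..n}"
  have "(\<forall>x. vfield n (phase n \<xi>) (\<lambda>u. \<alpha> * x u) i = 0) \<longleftrightarrow> (\<forall>y. vfield n (phase n \<xi>) y i = 0)"
    using exists_scaled[of \<alpha>] assms(2) by (metis less_irrefl)
  then show "(\<forall>x. vel n \<alpha> vr \<xi> i x = 0) \<longleftrightarrow> (\<forall>y. vfield n (phase n \<xi>) y i = 0)"
    using i assms by (simp add: vel_eq_vfield)
qed

section \<open>The reduction condition as a balance of sources and slopes\<close>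

text \<open>
  In \<open>v j * \<partial>j (v i)\<close> with \<open>j = i + k\<close>, \<open>slope\<close> is what wave \<open>t\<close> of component \<open>i\<close> contributes, \<open>source\<close>
  is what wave \<open>s\<close> of component \<open>j\<close> contributes, both without the factor that contains coordinate
  \<open>i\<close>; these two factors average to the sine of a difference of phases that enters \<open>drift\<close>. The
  argument \<open>c u\<close> is \<open>\<pi> / 2\<close> minus the coordinate at offset \<open>u\<close> from \<open>i\<close>, so that an undifferentiated
  factor vanishes exactly when \<open>c u\<close> has the direction of its phase.
\<close>

definition slope :: "nat \<Rightarrow> (int \<Rightarrow> real) \<Rightarrow> int \<Rightarrow> int \<Rightarrow> (int \<Rightarrow> real) \<Rightarrow> real" where
  "slope n e t k c =
     cos (c k - e (k + t)) * (\<Prod>u\<in>{1..<int n} - {k}. sin (c u - e (u + t)))"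

definition source :: "nat \<Rightarrow> (int \<Rightarrow> real) \<Rightarrow> int \<Rightarrow> int \<Rightarrow> (int \<Rightarrow> real) \<Rightarrow> real" where
  "source n e s k c =
     cos (c k - e s) * (\<Prod>u\<in>{1..<int n} - {k}. sin (c u - e (u - k + s)))"

definition drift :: "nat \<Rightarrow> (int \<Rightarrow> real) \<Rightarrow> int \<Rightarrow> int \<Rightarrow> (int \<Rightarrow> real) \<Rightarrow> real" where
  "drift n e t k c = sin (e t - e (- k)) * source n e 0 k c
                   - sin (e t - e (1 - k)) * source n e 1 k c"

text \<open>
  The summand \<open>j = i\<close> averages a derivative of \<open>(v i)\<^sup>2 / 2\<close> and drops out. In the others one factor of
  each wave contains coordinate \<open>i\<close>, and \<open>sin (y + a) cos (y + b)\<close> has mean \<open>sin (a - b) / 2\<close>; the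
  remaining factors do not depend on that coordinate.
\<close>

lemma mean_convection_eq_balance:
  assumes i: "i \<in> {1..n}" and per: "\<And>m. e (m + int n) = e m"
    and c: "\<And>d. c d = pi / 2 - y (cyc n (int i + d))"
  shows "mean_convection n e y i = - (\<Sum>k\<in>{1..<int n}. slope n e 0 k c * drift n e 0 k c
                                                   - slope n e 1 k c * drift n e 1 k c)"
proof -
  define A where "A t j = sin (y j + e (int j - int i + t))
      * (\<Prod>u\<in>{1..n} - {i} - {j}. cos (y u + e (int u - int i + t)))" for t j
  define B where "B s j = sin (y j + e s)
      * (\<Prod>u\<in>{1..n} - {i} - {j}. cos (y u + e (int u - int j + s)))" for s j
  define T where "T j = vfield n e y j * vfield n e (advance j y) i
      + vfield n e (advance i y) j * vfield n e (advance j (advance i y)) i" for j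
  have T: "T j = - (A 0 j * (sin (e 0 - e (int i - int j)) * B 0 j - sin (e 0 - e (int i - int j + 1)) * B 1 j)
      - A 1 j * (sin (e 1 - e (int i - int j)) * B 0 j - sin (e 1 - e (int i - int j + 1)) * B 1 j))"
    if j: "j \<in> {1..n} - {i}" for j
  proof -
    have wave_j: "wave n (\<lambda>m. e (m + s)) y' j = B s j * cos (y' i + e (int i - int j + s))"
      if y': "\<And>u. u \<noteq> i \<Longrightarrow> y' u = y u" for s y'
    proof -
      have "(\<Prod>u\<in>{1..n} - {j}. cos (y' u + e (int u - int j + s)))
          = cos (y' i + e (int i - int j + s)) * (\<Prod>u\<in>{1..n} - {j} - {i}. cos (y' u + e (int u - int j + s)))"
        using i j by (subst prod.remove[of _ i]) auto
      also have "(\<Prod>u\<in>{1..n} - {j} - {i}. cos (y' u + e (int u - int j + s)))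
          = (\<Prod>u\<in>{1..n} - {i} - {j}. cos (y u + e (int u - int j + s)))"
        by (rule prod.cong) (use y' in auto)
      finally show ?thesis using y'[of j] j by (simp add: wave_def B_def)
    qed
    have wave_i: "wave n (\<lambda>m. e (m + t)) (advance j y') i = - sin (y' i + e t) * A t j"
      if y': "\<And>u. u \<noteq> i \<Longrightarrow> y' u = y u" for t y'
    proof -
      have "(\<Prod>u\<in>{1..n} - {i}. cos (advance j y' u + e (int u - int i + t)))
          = cos (advance j y' j + e (int j - int i + t))
            * (\<Prod>u\<in>{1..n} - {i} - {j}. cos (advance j y' u + e (int u - int i + t)))"
        using i j by (subst prod.remove[of _ j]) auto
      also have "(\<Prod>u\<in>{1..n} - {i} - {j}. cos (advance j y' u + e (int u - int i + t)))
          = (\<Prod>u\<in>{1..n} - {i} - {j}. cos (y u + e (int u - int i + t)))"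
        by (rule prod.cong) (use y' in \<open>auto simp: advance_def\<close>)
      also have "cos (advance j y' j + e (int j - int i + t)) = - sin (y j + e (int j - int i + t))"
        using y'[of j] j by (simp add: advance_def sin_add cos_add)
      finally show ?thesis using j by (simp add: wave_def A_def advance_def)
    qed
    have V1: "vfield n e y' j = B 0 j * cos (y' i + e (int i - int j)) - B 1 j * cos (y' i + e (int i - int j + 1))"
      and V2: "vfield n e (advance j y') i = sin (y' i + e 1) * A 1 j - sin (y' i + e 0) * A 0 j"
      if "\<And>u. u \<noteq> i \<Longrightarrow> y' u = y u" for y'
      using wave_j[OF that, of 0] wave_j[OF that, of 1] wave_i[OF that, of 0] wave_i[OF that, of 1]
      by (simp_all add: vfield_def)
    have q: "cos (advance i y i + a) = - sin (y i + a)" "sin (advance i y i + a) = cos (y i + a)" for a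
      by (simp_all add: advance_def sin_add cos_add)
    have d: "sin (e t - a) = sin (y i + e t) * cos (y i + a) - cos (y i + e t) * sin (y i + a)" for t a
      using sin_diff[of "y i + e t" "y i + a"] by simp
    have V: "vfield n e y j = B 0 j * cos (y i + e (int i - int j)) - B 1 j * cos (y i + e (int i - int j + 1))"
      "vfield n e (advance i y) j = - B 0 j * sin (y i + e (int i - int j)) + B 1 j * sin (y i + e (int i - int j + 1))"
      "vfield n e (advance j y) i = sin (y i + e 1) * A 1 j - sin (y i + e 0) * A 0 j"
      "vfield n e (advance j (advance i y)) i = cos (y i + e 1) * A 1 j - cos (y i + e 0) * A 0 j"
      using V1[of y] V2[of y] V1[of "advance i y"] V2[of "advance i y"] q by (simp_all add: advance_def)
    show ?thesis
      unfolding T_def V d by (simp add: algebra_simps)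
  qed
  have n: "n > 0" using i by auto
  \<comment> \<open>half a period changes the sign of the velocity\<close>
  have Ti: "T i = 0" using i vfield_advance_advance[of i n e y i] by (simp add: T_def)
  have em: "e a = e b" if "a mod int n = b mod int n" for a b
    using periodic_mod[of e n, OF per] that by metis
  let ?p = "\<lambda>d. cyc n (int i + d)"
  have pm: "int (?p d) mod int n = (int i + d) mod int n" for d by (rule cyc_mod[OF n])
  have off: "e (int (?p u) - int i + t) = e (u + t)" "e (int i - int (?p u) + t) = e (t - u)"
    "e (int (?p u) - int (?p k) + t) = e (u - k + t)" for u k t
  proof -
    have "(int (?p u) - int i + t) mod int n = ((int i + u) - int i + t) mod int n"
      "(int i - int (?p u) + t) mod int n = (int i - (int i + u) + t) mod int n"
      "(int (?p u) - int (?p k) + t) mod int n = ((int i + u) - (int i + k) + t) mod int n"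
      by (intro mod_add_cong mod_diff_cong pm refl)+
    then show "e (int (?p u) - int i + t) = e (u + t)" "e (int i - int (?p u) + t) = e (t - u)"
      "e (int (?p u) - int (?p k) + t) = e (u - k + t)"
      by (intro em; simp)+
  qed
  have bij: "bij_betw ?p ({1..<int n} - {k}) ({1..n} - {i} - {?p k})" if "k \<in> {1..<int n}" for k
  proof (rule bij_betw_DiffI[OF cyc_offsets_bij[OF i]])
    show "bij_betw ?p {k} {?p k}" by (simp add: bij_betw_def)
    show "{?p k} \<subseteq> {1..n} - {i}" using bij_betw_apply[OF cyc_offsets_bij[OF i] that] by (simp only: insert_subset empty_subsetI)
  qed (use that in auto)
  have q: "cos (pi / 2 - a - b) = sin (a + b)" "sin (pi / 2 - a - b) = cos (a + b)" for a b :: real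
    by (simp_all add: sin_cos_eq[of "a + b"] cos_sin_eq[of "a + b"] diff_diff_eq)
  have Ap: "A t (?p k) = slope n e t k c" if "k \<in> {1..<int n}" for t k
    using prod.reindex_bij_betw[OF bij[OF that], of "\<lambda>u. cos (y u + e (int u - int i + t))"]
    by (simp add: A_def slope_def c off q)
  have Bp: "B s (?p k) = source n e s k c" if "k \<in> {1..<int n}" for s k
    using prod.reindex_bij_betw[OF bij[OF that], of "\<lambda>u. cos (y u + e (int u - int (?p k) + s))"]
    by (simp add: B_def source_def c off q)
  have "mean_convection n e y i = (\<Sum>j\<in>{1..n} - {i}. T j)"
    using i Ti by (simp add: mean_convection_def T_def sum.remove[of _ i])
  also have "\<dots> = (\<Sum>k\<in>{1..<int n}. T (?p k))"
    by (rule sum.reindex_bij_betw[OF cyc_offsets_bij[OF i], symmetric])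
  also have "\<dots> = (\<Sum>k\<in>{1..<int n}. - (slope n e 0 k c * drift n e 0 k c - slope n e 1 k c * drift n e 1 k c))"
  proof (rule sum.cong[OF refl])
    fix k assume k: "k \<in> {1..<int n}"
    then have "?p k \<in> {1..n} - {i}" by (rule bij_betw_apply[OF cyc_offsets_bij[OF i]])
    then show "T (?p k) = - (slope n e 0 k c * drift n e 0 k c - slope n e 1 k c * drift n e 1 k c)"
      using off(2)[of k 0] off(2)[of k 1] by (simp add: T Ap[OF k] Bp[OF k] drift_def)
  qed
  finally show ?thesis unfolding sum_negf .
qed

section \<open>Isolating single terms of the balance\<close>

text \<open>
  When all phases have the direction of \<open>e 0\<close> or the orthogonal one, whether the product of
  \<open>sin (e t - e (s - k))\<close>, \<open>slope t k\<close> and \<open>source s k\<close> vanishes is a matter of bits. Here \<open>S\<close> is the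
  set of offsets whose phase is orthogonal to \<open>e 0\<close>, and \<open>q u\<close> says where \<open>c u\<close> is placed: on the
  direction of \<open>e 0\<close> (\<open>Some False\<close>), on the orthogonal one (\<open>Some True\<close>), or off both (\<open>None\<close>).
\<close>

definition alive :: "nat \<Rightarrow> int set \<Rightarrow> (int \<Rightarrow> bool option) \<Rightarrow> int \<Rightarrow> int \<Rightarrow> int \<Rightarrow> bool" where
  "alive n S q k t s \<longleftrightarrow> (let \<beta> = (\<lambda>u. u mod int n \<in> S) in \<beta> t \<noteq> \<beta> (s - k) \<and>
     q k \<noteq> Some (\<not> \<beta> (k + t)) \<and> q k \<noteq> Some (\<not> \<beta> s) \<and>
     (\<forall>u\<in>{1..<int n} - {k}. q u \<noteq> Some (\<beta> (u + t)) \<and> q u \<noteq> Some (\<beta> (u - k + s))))"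

definition survivors :: "nat \<Rightarrow> int set \<Rightarrow> (int \<Rightarrow> bool option) \<Rightarrow> (int \<times> int \<times> int) list" where
  "survivors n S q = filter (\<lambda>(k, t, s). alive n S q k t s)
     (List.product [1..int n - 1] (List.product [0, 1] [0, 1]))"

text \<open>
  The phases that satisfy the reduction condition for the component of index \<open>n\<close>, from which the
  offset of coordinate \<open>u\<close> is \<open>u\<close> itself.
\<close>

locale balanced_phases =
  fixes n :: nat and e :: "int \<Rightarrow> real"
  assumes period: "\<And>u. e (u + int n) = e u"
    and n_pos: "n > 0"
    and balance: "\<And>c. (\<Sum>k\<in>{1..<int n}. slope n e 0 k c * drift n e 0 k c
                                    - slope n e 1 k c * drift n e 1 k c) = 0"
begin

abbreviation I :: "int set" where "I \<equiv> {1..<int n}"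

definition z :: "int \<Rightarrow> complex" where "z u = dir (e u)"

definition jump :: "int \<Rightarrow> bool" where "jump u \<longleftrightarrow> z (u + 1) \<noteq> z u"

lemma z_period: "z (u + int n) = z u"
  by (simp add: z_def period)

lemma z_mod: "z (u mod int n) = z u"
  by (rule periodic_mod) (rule z_period)

lemma finite_range_z: "finite (range z)"
proof -
  have "range z \<subseteq> z ` {0..<int n}"
  proof
    fix v assume "v \<in> range z"
    then obtain u where "v = z u" by blast
    then have "v = z (u mod int n)" by (simp add: z_mod)
    then show "v \<in> z ` {0..<int n}" using n_pos by auto
  qed
  then show ?thesis using finite_subset by blast
qed

lemma z_simps [simp]: "z u \<noteq> - z u" "- z u \<noteq> z u" "z u \<noteq> 0"
  by (simp_all add: z_def)

definition generic :: "real \<Rightarrow> bool" where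
  "generic \<gamma> \<longleftrightarrow> (\<forall>u. dir \<gamma> \<noteq> z u \<and> dir \<gamma> \<noteq> - z u)"

lemma generic_pair:
  obtains \<gamma>1 \<gamma>2 where "generic \<gamma>1" "generic \<gamma>2" "dir \<gamma>1 \<noteq> dir \<gamma>2"
proof -
  define F where "F = range z \<union> uminus ` range z"
  have f: "finite F" unfolding F_def using finite_range_z by blast
  have gen: "generic \<gamma>" if "dir \<gamma> \<notin> F" for \<gamma>
    unfolding generic_def using that unfolding F_def by blast
  obtain \<gamma>1 where 1: "dir \<gamma>1 \<notin> F" using exists_generic_dir[OF f] by blast
  obtain \<gamma>2 where 2: "dir \<gamma>2 \<notin> insert (dir \<gamma>1) F"
    using exists_generic_dir[of "insert (dir \<gamma>1) F"] f by blast
  then have "dir \<gamma>2 \<notin> F" and ne: "dir \<gamma>1 \<noteq> dir \<gamma>2" by force+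
  then show thesis using gen[OF 1] gen[of \<gamma>2] ne by (intro that[of \<gamma>1 \<gamma>2])
qed

lemma sin_e_zero: "sin (\<gamma> - e u) = 0 \<longleftrightarrow> dir \<gamma> = z u"
  and cos_e_zero: "cos (\<gamma> - e u) = 0 \<longleftrightarrow> dir \<gamma> = - z u"
  by (simp_all add: z_def dir_diff dir_orth)

lemma slope_zero_iff:
  "slope n e t k c = 0 \<longleftrightarrow> dir (c k) = - z (k + t) \<or> (\<exists>u\<in>I - {k}. dir (c u) = z (u + t))"
  by (simp add: slope_def sin_e_zero cos_e_zero)

lemma source_zero_iff:
  "source n e s k c = 0 \<longleftrightarrow> dir (c k) = - z s \<or> (\<exists>u\<in>I - {k}. dir (c u) = z (u - k + s))"
  by (simp add: source_def sin_e_zero cos_e_zero)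

lemma isolated_drift:
  assumes "t \<in> {0, 1}" "k \<in> I"
    and "slope n e t k c \<noteq> 0"
    and "\<And>j. j \<in> I - {k} \<Longrightarrow> slope n e t j c * drift n e t j c = 0"
    and "\<And>j. j \<in> I \<Longrightarrow> slope n e (1 - t) j c * drift n e (1 - t) j c = 0"
  shows "drift n e t k c = 0"
proof -
  have "0 = (\<Sum>j\<in>I. slope n e 0 j c * drift n e 0 j c - slope n e 1 j c * drift n e 1 j c)"
    by (simp add: balance)
  also have "\<dots> = (\<Sum>j\<in>{k}. slope n e 0 j c * drift n e 0 j c - slope n e 1 j c * drift n e 1 j c)"
  proof (rule sum.mono_neutral_right)
    show "\<forall>j\<in>I - {k}. slope n e 0 j c * drift n e 0 j c - slope n e 1 j c * drift n e 1 j c = 0"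
    proof
      fix j assume j: "j \<in> I - {k}"
      have "t = 0 \<or> t = 1" using assms(1) by blast
      then show "slope n e 0 j c * drift n e 0 j c - slope n e 1 j c * drift n e 1 j c = 0"
        using assms(4)[OF j] assms(5)[of j] j by auto
    qed
  qed (use assms(2) in auto)
  also have "\<dots> = slope n e 0 k c * drift n e 0 k c - slope n e 1 k c * drift n e 1 k c" by simp
  finally show ?thesis using assms(1,2,3) assms(5)[OF \<open>k \<in> I\<close>] by auto
qed

text \<open>
  Zeros of the other wave at two sites kill all its slopes, because only one of the two factors can
  be the differentiated one. A zero of wave \<open>t\<close> at \<open>k\<close> kills all its slopes except the one at \<open>k\<close>,
  where this factor is differentiated. So the balance has one summand left.
\<close>

lemma drift_vanishes:
  assumes "t \<in> {0, 1}" "k \<in> I" "a \<in> I" "b \<in> I" "a \<noteq> b"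
    and a: "dir (c a) = z (a + 1 - t)" and b: "dir (c b) = z (b + 1 - t)"
    and k: "dir (c k) = z (k + t)"
    and gen: "\<And>u. u \<in> I - {k} \<Longrightarrow> dir (c u) \<noteq> z (u + t)"
  shows "drift n e t k c = 0"
proof (rule isolated_drift)
  show "slope n e t k c \<noteq> 0"
    using k gen by (auto simp: slope_zero_iff)
  show "slope n e t j c * drift n e t j c = 0" if "j \<in> I - {k}" for j
    using that k \<open>k \<in> I\<close> by (auto simp: slope_zero_iff)
  show "slope n e (1 - t) j c * drift n e (1 - t) j c = 0" if "j \<in> I" for j
  proof -
    have "a \<noteq> j \<or> b \<noteq> j" using \<open>a \<noteq> b\<close> by blast
    then have "slope n e (1 - t) j c = 0"
      unfolding slope_zero_iff using a b assms(3,4) by (auto simp: algebra_simps)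
    then show ?thesis by simp
  qed
qed (use assms in auto)

text \<open>
  As functions of \<open>c w\<close> alone the two sources are sinusoids whose zeros differ, because \<open>w - k\<close> is a
  jump. If their combination \<open>drift\<close> vanishes for two directions of \<open>c w\<close>, both coefficients vanish.
\<close>

lemma drift_split:
  assumes w: "w \<in> I - {k}" and "jump (w - k)" and ne: "dir \<gamma>1 \<noteq> dir \<gamma>2" and s: "s \<in> {0, 1}"
    and drift: "\<And>\<gamma>. \<gamma> \<in> {\<gamma>1, \<gamma>2} \<Longrightarrow> drift n e t k (c(w := \<gamma>)) = 0"
  shows "z t = z (s - k) \<or> dir (c k) = - z s \<or> (\<exists>u\<in>I - {k, w}. dir (c u) = z (u - k + s))"
proof -
  define L where "L s = sin (e t - e (s - k)) * (cos (c k - e s) *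
     (\<Prod>u\<in>I - {k, w}. sin (c u - e (u - k + s))))" for s
  have cw: "sin (e t - e (s - k)) * source n e s k (c(w := \<gamma>)) = L s * sin (\<gamma> - e (w - k + s))"
    for s \<gamma>
  proof -
    have "(\<Prod>u\<in>I - {k}. sin ((c(w := \<gamma>)) u - e (u - k + s)))
        = sin (\<gamma> - e (w - k + s)) * (\<Prod>u\<in>I - {k} - {w}. sin ((c(w := \<gamma>)) u - e (u - k + s)))"
      using w by (subst prod.remove[of _ w]) auto
    also have "(\<Prod>u\<in>I - {k} - {w}. sin ((c(w := \<gamma>)) u - e (u - k + s)))
        = (\<Prod>u\<in>I - {k, w}. sin (c u - e (u - k + s)))"
      by (rule prod.cong) auto
    finally show ?thesis using w by (simp add: source_def L_def)
  qed
  have eq: "L 0 * sin (\<gamma> - e (w - k)) = L 1 * sin (\<gamma> - e (w - k + 1))" if "\<gamma> \<in> {\<gamma>1, \<gamma>2}" for \<gamma>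
    using drift[OF that] cw[of 0 \<gamma>] cw[of 1 \<gamma>] by (simp add: drift_def)
  have ne': "dir (e (w - k)) \<noteq> dir (e (w - k + 1))"
    using \<open>jump (w - k)\<close> by (auto simp: jump_def z_def)
  have "L 0 = 0" "L 1 = 0"
    by (rule sinusoids_independent[OF _ ne ne'], erule eq)+
  then have "L s = 0" using s by auto
  then have "sin (e t - e (s - k)) = 0 \<or> cos (c k - e s) = 0 \<or>
      (\<exists>u\<in>I - {k, w}. sin (c u - e (u - k + s)) = 0)"
    unfolding L_def by simp
  then show ?thesis
    unfolding sin_e_zero cos_e_zero unfolding z_def .
qed

text \<open>
  Says that source \<open>s\<close> enters \<open>drift t k\<close> with a nonzero coefficient when the sites of \<open>U\<close> are placed
  at zeros of the other wave, \<open>k\<close> at the zero of wave \<open>t\<close>, and all remaining sites generically.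
\<close>

definition contributes :: "int \<Rightarrow> int \<Rightarrow> int \<Rightarrow> int set \<Rightarrow> bool" where
  "contributes t k s U \<longleftrightarrow> z t \<noteq> z (s - k) \<and> z (k + t) \<noteq> - z s \<and>
     (\<forall>u\<in>U - {k}. z (u + 1 - t) \<noteq> z (u - k + s))"

text \<open>
  One of the two sites \<open>a\<close>, \<open>b\<close> may be \<open>k\<close> itself if \<open>k\<close> is not a jump: there the two waves have a
  common zero.
\<close>

context
  fixes t k a b :: int
  assumes t: "t \<in> {0, 1}" and I: "k \<in> I" "a \<in> I" "b \<in> I" and "a \<noteq> b"
    and jumps: "\<And>u. u \<in> {a, b} \<Longrightarrow> jump u \<longleftrightarrow> u \<noteq> k"
begin

definition probe :: "real \<Rightarrow> int \<Rightarrow> real" where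
  "probe \<gamma> = (\<lambda>u. if u = k then e (k + t) else if u \<in> {a, b} then e (u + 1 - t) else \<gamma>)"

lemma probe_drift:
  assumes "\<And>u. u \<in> I - {k, a, b} \<Longrightarrow> generic (c u)"
    and "\<And>u. u \<in> {k, a, b} \<Longrightarrow> c u = probe \<gamma> u"
  shows "drift n e t k c = 0"
proof (rule drift_vanishes[OF t I \<open>a \<noteq> b\<close>])
  have *: "dir (c u) = z (u + 1 - t)" if "u \<in> {a, b}" for u
  proof (cases "u = k")
    case True
    then have "z (k + 1) = z k" using jumps that unfolding jump_def by blast
    then show ?thesis using True assms(2)[of k] t by (auto simp: probe_def z_def)
  next
    case False
    then show ?thesis using assms(2)[of u] that by (auto simp: probe_def z_def)
  qed
  show "dir (c a) = z (a + 1 - t)" "dir (c b) = z (b + 1 - t)" using * by blast+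
  show "dir (c k) = z (k + t)" using assms(2)[of k] by (simp add: probe_def z_def)
  fix u assume u: "u \<in> I - {k}"
  show "dir (c u) \<noteq> z (u + t)"
  proof (cases "u \<in> {a, b}")
    case True
    then have "z (u + 1) \<noteq> z u" using jumps u unfolding jump_def by blast
    then show ?thesis using *[OF True] t by auto
  next
    case False
    then show ?thesis using assms(1)[of u] u unfolding generic_def by blast
  qed
qed

lemma contributes_iff: "contributes t k 0 {a, b} \<longleftrightarrow> contributes t k 1 {a, b}"
proof -
  obtain \<gamma> where g: "generic \<gamma>" using generic_pair by blast
  have d: "drift n e t k (probe \<gamma>) = 0"
    by (rule probe_drift) (use g in \<open>auto simp: probe_def\<close>)
  have contributes: "sin (e t - e (s - k)) * source n e s k (probe \<gamma>) = 0
      \<longleftrightarrow> \<not> contributes t k s {a, b}" for s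
  proof -
    have 1: "(\<exists>u\<in>I - {k}. dir (probe \<gamma> u) = z (u - k + s))
         \<longleftrightarrow> (\<exists>u\<in>{a, b} - {k}. z (u + 1 - t) = z (u - k + s))"
      using g I unfolding generic_def probe_def z_def by auto
    have 2: "dir (probe \<gamma> k) = z (k + t)" by (simp add: probe_def z_def)
    have 3: "sin (e t - e (s - k)) = 0 \<longleftrightarrow> z t = z (s - k)" by (simp add: z_def dir_diff)
    show ?thesis unfolding mult_eq_0_iff source_zero_iff contributes_def 1 2 3 by blast
  qed
  have "sin (e t - e (0 - k)) * source n e 0 k (probe \<gamma>)
      = sin (e t - e (1 - k)) * source n e 1 k (probe \<gamma>)"
    using d by (simp add: drift_def)
  then show ?thesis using contributes[of 0] contributes[of 1] by argo
qed

lemma not_contributes: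
  assumes w: "w \<in> I - {k, a, b}" and "jump (w - k)" and s: "s \<in> {0, 1}"
  shows "\<not> contributes t k s {a, b}"
proof -
  obtain \<gamma>1 \<gamma>2 where g: "generic \<gamma>1" "generic \<gamma>2" "dir \<gamma>1 \<noteq> dir \<gamma>2" using generic_pair by blast
  have "z t = z (s - k) \<or> dir (probe \<gamma>1 k) = - z s \<or>
      (\<exists>u\<in>I - {k, w}. dir (probe \<gamma>1 u) = z (u - k + s))"
  proof (rule drift_split[OF _ \<open>jump (w - k)\<close> g(3) s])
    fix \<gamma> assume "\<gamma> \<in> {\<gamma>1, \<gamma>2}"
    then show "drift n e t k ((probe \<gamma>1)(w := \<gamma>)) = 0"
      by (intro probe_drift[where \<gamma> = \<gamma>1]) (use g w in \<open>auto simp: probe_def\<close>)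
  qed (use w in auto)
  moreover have "(\<exists>u\<in>I - {k, w}. dir (probe \<gamma>1 u) = z (u - k + s)) \<longrightarrow>
      (\<exists>u\<in>{a, b} - {k}. z (u + 1 - t) = z (u - k + s))"
    using g(1) I unfolding generic_def probe_def z_def by auto
  moreover have "dir (probe \<gamma>1 k) = z (k + t)" by (simp add: probe_def z_def)
  ultimately show ?thesis unfolding contributes_def by (metis (no_types, lifting))
qed

end

section \<open>Jumps between neighbouring phases\<close>

lemma z_minus_period: "z (u - int n) = z u"
  using z_period[of "u - int n"] by simp

text \<open>
  Two sources whose difference is zero vanish together. The form with \<open>k'\<close> allows \<open>k\<close> to be written
  as a small negative offset.
\<close>

lemma pair_rule:
  assumes "t \<in> {0, 1}" "s \<in> {0, 1}" "k \<in> I" and k': "k' = k \<or> k' = k - int n"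
    and "a \<in> I - {k}" "b \<in> I - {k}" "a \<noteq> b" "jump a" "jump b"
    and other: "z t = z (1 - s - k') \<or> z (k' + t) = - z (1 - s) \<or>
      z (a + 1 - t) = z (a - k' + (1 - s)) \<or> z (b + 1 - t) = z (b - k' + (1 - s))"
  shows "z t = z (s - k') \<or> z (k' + t) = - z s \<or>
      z (a + 1 - t) = z (a - k' + s) \<or> z (b + 1 - t) = z (b - k' + s)"
proof -
  have shift: "z (r - k) = z (r - k')" "z (k + r) = z (k' + r)" "z (u - k + r) = z (u - k' + r)" for r u
    using k' z_period[of "r - k"] z_minus_period[of "k + r"] z_period[of "u - k + r"]
    by (auto simp: algebra_simps)
  have contributes: "contributes t k r {a, b} \<longleftrightarrow> \<not> (z t = z (r - k') \<or> z (k' + t) = - z r \<or>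
      z (a + 1 - t) = z (a - k' + r) \<or> z (b + 1 - t) = z (b - k' + r))" for r
    using assms(5,6) unfolding contributes_def shift by auto
  have "contributes t k 0 {a, b} \<longleftrightarrow> contributes t k 1 {a, b}"
    by (rule contributes_iff) (use assms in auto)
  moreover have "\<not> contributes t k (1 - s) {a, b}" using other contributes[of "1 - s"] by blast
  ultimately have "\<not> contributes t k s {a, b}" using assms(2) by auto
  then show ?thesis using contributes[of s] by blast
qed

text \<open>
  At \<open>k = -1\<close> the first source has coefficient \<open>sin (e 1 - e 1)\<close>, so the second one has to vanish
  by itself.
\<close>

lemma step_two_rule:
  assumes "jump 1" "z 1 \<noteq> - z 0"
    and "a \<in> I - {int n - 1}" "b \<in> I - {int n - 1}" "a \<noteq> b" "jump a" "jump b"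
  shows "z (a + 2) = z a \<or> z (b + 2) = z b"
proof -
  have "z 1 = z (1 - (-1)) \<or> z (-1 + 1) = - z 1 \<or>
      z (a + 1 - 1) = z (a - (-1) + 1) \<or> z (b + 1 - 1) = z (b - (-1) + 1)"
    by (rule pair_rule[where k = "int n - 1"]) (use assms in auto)
  then show ?thesis using assms by (auto simp: jump_def add.commute)
qed

text \<open>
  The mirror image of \<open>step_two_rule\<close> under \<open>d \<mapsto> 1 - d\<close>, which exchanges the two waves.
\<close>

lemma step_two_rule':
  assumes "jump (-1)" "z 1 \<noteq> - z 0"
    and "a \<in> I - {1}" "b \<in> I - {1}" "a \<noteq> b" "jump a" "jump b"
  shows "z (a + 1) = z (a - 1) \<or> z (b + 1) = z (b - 1)"
proof -
  have "z 0 = z (0 - 1) \<or> z (1 + 0) = - z 0 \<or>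
      z (a + 1 - 0) = z (a - 1 + 0) \<or> z (b + 1 - 0) = z (b - 1 + 0)"
    by (rule pair_rule[where k = 1]) (use assms in auto)
  then show ?thesis using assms by (auto simp: jump_def)
qed

text \<open>
  Again \<open>k = -1\<close>, with the two waves exchanged: the first source is zero because its phase at \<open>a\<close>
  is the one at which \<open>c a\<close> was placed.
\<close>

lemma adjacent_jumps_rule:
  assumes "z 2 \<noteq> z 0" "z (-1) \<noteq> - z 1"
    and "a \<in> I - {int n - 1}" "b \<in> I - {int n - 1}" "a \<noteq> b" "jump a" "jump b"
  shows "\<not> jump (a + 1) \<or> \<not> jump (b + 1)"
proof -
  have "z 0 = z (1 - (-1)) \<or> z (-1 + 0) = - z 1 \<or>
      z (a + 1 - 0) = z (a - (-1) + 1) \<or> z (b + 1 - 0) = z (b - (-1) + 1)"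
    by (rule pair_rule[where k = "int n - 1"]) (use assms in auto)
  then show ?thesis using assms(1,2) by (auto simp: jump_def)
qed

lemma adjacent_jumps_rule':
  assumes "z (-1) \<noteq> z 1" "z 2 \<noteq> - z 0"
    and "a \<in> I - {1}" "b \<in> I - {1}" "a \<noteq> b" "jump a" "jump b"
  shows "\<not> jump (a - 1) \<or> \<not> jump (b - 1)"
proof -
  have "z 1 = z (0 - 1) \<or> z (1 + 1) = - z 0 \<or>
      z (a + 1 - 1) = z (a - 1 + 0) \<or> z (b + 1 - 1) = z (b - 1 + 0)"
    by (rule pair_rule[where k = 1]) (use assms in auto)
  then show ?thesis using assms(1,2) by (auto simp: jump_def)
qed

text \<open>
  Here \<open>k = -2\<close>, and the first source is zero because positions 1 and 2 agree.
\<close>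

lemma step_three_rule:
  assumes "z 2 = z 1" "z 3 \<noteq> z 1" "z (-1) \<noteq> - z 1" "n > 2"
    and "a \<in> I - {int n - 2}" "b \<in> I - {int n - 2}" "a \<noteq> b" "jump a" "jump b"
  shows "z (a + 3) = z a \<or> z (b + 3) = z b"
proof -
  have "z 1 = z (1 - (-2)) \<or> z (-2 + 1) = - z 1 \<or>
      z (a + 1 - 1) = z (a - (-2) + 1) \<or> z (b + 1 - 1) = z (b - (-2) + 1)"
    by (rule pair_rule[where k = "int n - 2"]) (use assms in auto)
  then show ?thesis using assms by (auto simp: add.commute)
qed

lemma all_jumps_rule:
  assumes "\<And>u. jump u" "t \<in> {0, 1}" "k \<in> I" "a \<in> I - {k}" "b \<in> I - {k}" "a \<noteq> b"
    "w \<in> I - {k, a, b}" "s \<in> {0, 1}"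
  shows "z t = z (s - k) \<or> z (k + t) = - z s \<or> z (a + 1 - t) = z (a - k + s)
       \<or> z (b + 1 - t) = z (b - k + s)"
proof -
  have "\<not> contributes t k s {a, b}"
    by (rule not_contributes[where w = w]) (use assms in auto)
  then show ?thesis unfolding contributes_def by auto
qed

lemma jump_mod: "jump (u mod int n) \<longleftrightarrow> jump u"
  unfolding jump_def by (metis z_mod mod_add_left_eq)

text \<open>
  A cyclic sequence that changes at all has to change back.
\<close>

lemma constant_if_few_jumps:
  assumes "\<And>u. u \<in> {0..<int n} - {j} \<Longrightarrow> \<not> jump u" "j \<in> {0..<int n}"
  shows "z u = z 0"
proof -
  have step: "z (j + 1 + int m) = z (j + 1)" if "m < n" for m
    using that
  proof (induction m)
    case (Suc m)
    have "(j + 1 + int m) mod int n \<noteq> j"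
    proof
      assume "(j + 1 + int m) mod int n = j"
      then have "int n dvd 1 + int m"
        by (metis add.assoc add_diff_cancel_left' dvd_minus_mod dvd_0_right mod_eq_dvd_iff mod_mod_trivial)
      then show False using Suc.prems zdvd_imp_le[of "int n" "1 + int m"] by simp
    qed
    then have "\<not> jump (j + 1 + int m)"
      using assms(1)[of "(j + 1 + int m) mod int n"] n_pos by (simp add: jump_mod)
    then have "z (j + 1 + int m + 1) = z (j + 1 + int m)" by (simp add: jump_def)
    then show ?case using Suc by (simp add: algebra_simps)
  qed simp
  have all: "z v = z (j + 1)" for v
  proof -
    have "z v = z (j + 1 + (v - (j + 1)) mod int n)"
      by (metis z_mod mod_add_right_eq add.commute diff_add_cancel)
    also have "\<dots> = z (j + 1 + int (nat ((v - (j + 1)) mod int n)))" using n_pos by simp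
    also have "\<dots> = z (j + 1)"
      by (rule step) (use n_pos in \<open>simp add: nat_less_iff\<close>)
    finally show ?thesis .
  qed
  show ?thesis using all[of u] all[of 0] by simp
qed

lemma another_jump:
  assumes "\<not> (\<forall>u. z u = z 0)"
  obtains i where "i \<in> {0..<int n}" "i \<noteq> j" "jump i"
proof (cases "j \<in> {0..<int n}")
  case True
  then show thesis using that assms constant_if_few_jumps[of j] by blast
next
  case False
  obtain i where "i \<in> {0..<int n} - {0}" "jump i"
    using assms constant_if_few_jumps[of 0] n_pos by auto
  then show thesis using that[of i] False by blast
qed

text \<open>
  At a non-jump \<open>k\<close> the waves have a common zero, which removes every slope except those at \<open>k\<close>. A
  zero of either wave at a jump \<open>a\<close> then separates the two waves, and a site \<open>w\<close> with \<open>w - k\<close> a jump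
  separates the two sources. Since \<open>e 0\<close> and \<open>e 1\<close> agree, the conclusions for both waves together
  exclude that the zero at \<open>a\<close> was to blame.
\<close>

lemma non_jump_position:
  assumes "\<not> jump 0" "\<not> (\<forall>u. z u = z 0)" "k \<in> I" "\<not> jump k"
  shows "z k = - z 0 \<or> z (- k) = z 0 \<and> z (1 - k) = z 0"
proof -
  obtain i where i: "i \<in> {0..<int n}" "i \<noteq> (- k) mod int n" "jump i"
    using another_jump assms(2) by blast
  define w where "w = (i + k) mod int n"
  have i0: "i \<noteq> 0" using i assms(1) by metis
  have "w \<noteq> 0"
  proof
    assume "w = 0"
    then have "int n dvd i + k" unfolding w_def by auto
    then have "i mod int n = (- k) mod int n" by (simp add: mod_eq_dvd_iff)
    then show False using i by auto
  qed
  moreover have "w \<noteq> k"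
  proof
    assume "w = k"
    then have "int n dvd i" unfolding w_def
      by (metis add_diff_cancel_right' dvd_minus_mod dvd_0_right mod_eq_dvd_iff mod_mod_trivial)
    then show False using i i0 zdvd_imp_le[of "int n" i] by auto
  qed
  moreover have "0 \<le> w" "w < int n" using n_pos by (simp_all add: w_def)
  ultimately have w: "w \<in> I - {k}" by auto
  have jw: "jump (w - k)"
  proof -
    have "(w - k) mod int n = i mod int n"
      unfolding w_def by (metis add_diff_cancel_right' mod_diff_left_eq)
    then show ?thesis using i by (metis jump_mod)
  qed
  obtain a where a: "a \<in> {0..<int n}" "a \<noteq> w" "jump a" using another_jump assms(2) by blast
  have aI: "a \<in> I" "a \<noteq> k" using a assms by (auto simp: order.order_iff_strict)
  have ns: "\<not> contributes t k s {a, k}" if "t \<in> {0, 1}" "s \<in> {0, 1}" for t s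
    by (rule not_contributes[where w = w]) (use that aI a w jw assms in auto)
  have z1: "z 1 = z 0" "z (k + 1) = z k" using assms by (simp_all add: jump_def)
  have ne: "z (a + 1) \<noteq> z a" using a by (simp add: jump_def)
  have "z k = - z s \<or> z (s - k) = z 0" if "s \<in> {0, 1}" for s
    using ns[of 0 s] ns[of 1 s] that ne aI z1 unfolding contributes_def by auto
  from this[of 0] this[of 1] show ?thesis using z1 by auto
qed

text \<open>
  With only \<open>c k\<close> at the common zero of the two waves, the balance reduces to a relation between
  their drifts at \<open>k\<close>; if one of them is identically zero then so is the other.
\<close>

lemma non_jump_transfer:
  assumes k: "k \<in> I" "\<not> jump k" and w: "w \<in> I - {k}" "jump (w - k)" and t: "t \<in> {0, 1}"
    and zero: "\<And>s. s \<in> {0, 1} \<Longrightarrow> z t = z (s - k) \<or> z k = - z s" and s: "s \<in> {0, 1}"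
  shows "z (1 - t) = z (s - k) \<or> z k = - z s"
proof -
  obtain \<gamma>1 \<gamma>2 where g: "generic \<gamma>1" "generic \<gamma>2" "dir \<gamma>1 \<noteq> dir \<gamma>2" using generic_pair by blast
  define c where "c = (\<lambda>u. if u = k then e k else \<gamma>1)"
  have zk: "z (k + r) = z k" if "r \<in> {0, 1}" for r using k that by (auto simp: jump_def)
  have "z (1 - t) = z (s - k) \<or> dir (c k) = - z s \<or> (\<exists>u\<in>I - {k, w}. dir (c u) = z (u - k + s))"
  proof (rule drift_split[OF w g(3) s])
    fix \<gamma> assume \<gamma>: "\<gamma> \<in> {\<gamma>1, \<gamma>2}"
    let ?c = "c(w := \<gamma>)"
    have ck: "dir (?c k) = z k" using w by (simp add: c_def z_def)
    have cu: "generic (?c u)" if "u \<noteq> k" for u using that g \<gamma> by (auto simp: c_def)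
    have sl: "slope n e r j ?c = 0" if "j \<in> I - {k}" "r \<in> {0, 1}" for j r
      unfolding slope_zero_iff by (intro disjI2 bexI[of _ k]) (use that ck zk k in auto)
    show "drift n e (1 - t) k ?c = 0"
    proof (rule isolated_drift)
      show "slope n e (1 - t) k ?c \<noteq> 0"
      proof -
        have "z (k + (1 - t)) = z k" using zk[of "1 - t"] t by auto
        moreover have "dir (?c u) \<noteq> z (u + (1 - t))" if "u \<in> I - {k}" for u
          using cu that unfolding generic_def by blast
        ultimately show ?thesis unfolding slope_zero_iff ck by simp
      qed
      show "slope n e (1 - t) j ?c * drift n e (1 - t) j ?c = 0" if "j \<in> I - {k}" for j
        using sl[OF that, of "1 - t"] t by auto
      have "drift n e t k ?c = 0"
      proof -
        have "sin (e t - e (r - k)) * source n e r k ?c = 0" if "r \<in> {0, 1}" for r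
        proof -
          have "sin (e t - e (r - k)) = 0 \<longleftrightarrow> z t = z (r - k)" by (simp add: z_def dir_diff)
          then show ?thesis
            using zero[OF that] unfolding mult_eq_0_iff source_zero_iff ck by blast
        qed
        from this[of 0, unfolded diff_0] this[of 1] show ?thesis unfolding drift_def by simp_all (metis mult_eq_0_iff)
      qed
      then show "slope n e (1 - (1 - t)) j ?c * drift n e (1 - (1 - t)) j ?c = 0" if "j \<in> I" for j
        using sl[of j t] t that by (cases "j = k") auto
    qed (use t k in auto)
  qed
  moreover have "dir (c u) \<noteq> z (u - k + s)" if "u \<noteq> k" for u
    using g that by (auto simp: c_def generic_def)
  moreover have "dir (c k) = z k" by (simp add: c_def z_def)
  ultimately show ?thesis by auto
qed

text \<open>
  Suppose \<open>k\<close> is not a jump. Since \<open>n\<close> is prime, the multiples of \<open>k\<close> run through all positions, so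
  there is a jump \<open>a\<close> such that \<open>a - k\<close> is none. There both sources have the same phase, which a zero
  of one of the waves at \<open>a\<close> avoids; this kills the sources against that wave, and then against the
  other by \<open>non_jump_transfer\<close>. So each source \<open>s\<close> has its own factor at \<open>k\<close> zero, as \<open>e 0\<close> and \<open>e 1\<close>
  differ: \<open>e k\<close> is orthogonal to both, and they agree after all.
\<close>

lemma jump_everywhere:
  assumes "prime n" "n \<ge> 5" "jump 0"
  shows "jump u"
proof (rule ccontr)
  assume "\<not> jump u"
  moreover define k0 where "k0 = u mod int n"
  ultimately have nj: "\<not> jump k0" "0 \<le> k0" "k0 < int n" using n_pos by (simp_all add: jump_mod)
  then have k0: "k0 \<in> I" using \<open>jump 0\<close> by (auto simp: order.order_iff_strict)
  have nconst: "\<not> (\<forall>u. z u = z 0)" using \<open>jump 0\<close> by (auto simp: jump_def)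
  obtain r where "r \<in> {0..<int n}" "r \<noteq> 0" "jump r" using another_jump[OF nconst] by blast
  then have r: "r \<in> I" "jump r" by auto
  obtain k j where k: "k \<in> I" "\<not> jump k" and j: "j \<in> I" "jump j" "j \<noteq> int n - k"
  proof (cases "\<exists>k\<in>I. \<not> jump k \<and> r \<noteq> int n - k")
    case True
    then show thesis using that r by blast
  next
    case False
    then have r0: "r = int n - k0" using k0 nj by blast
    define j where "j = (if k0 \<in> {1, int n - 1} then 2 else 1 :: int)"
    have j: "j \<in> I" "j \<noteq> k0" "j \<noteq> int n - k0" using \<open>n \<ge> 5\<close> k0 by (auto simp: j_def)
    then have "jump j" using False r0 by force
    then show thesis using that[of k0 j] k0 nj j by blast
  qed
  define w where "w = (j + k) mod int n"
  have w: "w \<in> I - {k}"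
  proof -
    have "j + k < 2 * int n" using j k by auto
    moreover have "(j + k) mod int n = (j + k - int n) mod int n" by simp
    moreover have "(j + k - int n) mod int n = j + k - int n" if "j + k \<ge> int n"
      using that \<open>j + k < 2 * int n\<close> by (intro mod_pos_pos_trivial) auto
    ultimately have "w = (if j + k < int n then j + k else j + k - int n)"
      unfolding w_def using j k by (cases "j + k < int n") (auto simp only: mod_pos_pos_trivial if_True if_False not_less atLeastLessThan_iff, simp)
    then show ?thesis using j k by auto
  qed
  have jw: "jump (w - k)"
  proof -
    have "(w - k) mod int n = j mod int n"
      unfolding w_def by (metis add_diff_cancel_right' mod_diff_left_eq)
    then show ?thesis using j by (metis jump_mod)
  qed
  have cop: "coprime k (int n)"
  proof -
    have "\<not> int n dvd k" using k by (auto dest: zdvd_imp_le)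
    moreover have "prime (int n)" using \<open>prime n\<close> by simp
    ultimately show ?thesis using prime_imp_coprime coprime_commute by blast
  qed
  obtain i :: nat where i: "i \<ge> 1" "i < n" "jump (int i * k)"
  proof -
    obtain x' y' where "x' * k + y' * int n = 1"
      using bezout_int[of k "int n"] cop by auto
    then have "r * (x' * k + y' * int n) = r" by simp
    then have xr: "(r * x') * k = r + (- y' * r) * int n" by (simp add: algebra_simps)
    define x where "x = r * x'"
    define i where "i = nat (x mod int n)"
    have "int i = x mod int n" using n_pos by (simp add: i_def)
    then have "(int i * k) mod int n = r mod int n"
      using xr by (metis x_def mod_mult_left_eq mod_mult_self1)
    then have "jump (int i * k)" using r by (metis jump_mod)
    moreover have "i \<noteq> 0" using \<open>(int i * k) mod int n = r mod int n\<close> r by (auto intro!: Nat.gr0I)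
    moreover have "i < n" using \<open>int i = x mod int n\<close> n_pos by (metis of_nat_less_iff pos_mod_bound of_nat_0_less_iff)
    ultimately show thesis by (intro that[of i]) auto
  qed
  \<comment> \<open>the first multiple of \<open>k\<close> that is a jump; it is not \<open>k\<close>, so its predecessor is a non-jump other than 0\<close>
  define m where "m = (LEAST m::nat. m \<ge> 1 \<and> jump (int m * k))"
  have m: "m \<ge> 1 \<and> jump (int m * k)" unfolding m_def by (rule LeastI[of _ i]) (use i in auto)
  have mi: "m \<le> i" unfolding m_def by (rule Least_le) (use i in auto)
  have "m \<noteq> 1" using m k by auto
  then have m2: "m - 1 \<ge> 1" "m - 1 < m" using m by auto
  then have nm: "\<not> jump (int (m - 1) * k)" using not_less_Least[of "m - 1"] unfolding m_def by blast
  define a where "a = (int m * k) mod int n"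
  have ja: "jump a" using m by (simp add: a_def jump_mod)
  have "a \<noteq> 0"
  proof
    assume "a = 0"
    then have "int n dvd int m * k" by (auto simp: a_def)
    then have "int n dvd int m" using cop coprime_commute coprime_dvd_mult_left_iff by blast
    then show False using m mi i by (auto dest: dvd_imp_le)
  qed
  moreover have "0 \<le> a" "a < int n" using n_pos by (simp_all add: a_def)
  ultimately have a: "a \<in> I" "a \<noteq> k" using ja k by auto
  have nak: "\<not> jump (a - k)"
  proof -
    have "(a - k) mod int n = (int (m - 1) * k) mod int n"
      using m by (simp add: a_def mod_diff_left_eq of_nat_diff algebra_simps)
    then show ?thesis using nm by (metis jump_mod)
  qed
  then have "a \<noteq> w" using jw by blast
  have y: "z (a - k + s) = z (a - k)" if "s \<in> {0, 1}" for s
    using nak that by (auto simp: jump_def)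
  have zk: "z (k + t) = z k" if "t \<in> {0, 1}" for t using k that by (auto simp: jump_def)
  have contributes: "z t = z (s - k) \<or> z k = - z s"
    if "z (a + 1 - t) \<noteq> z (a - k)" "t \<in> {0, 1}" "s \<in> {0, 1}" for t s
  proof -
    have "\<not> contributes t k s {a, k}"
      by (rule not_contributes[where w = w]) (use that a k w jw ja \<open>a \<noteq> w\<close> in auto)
    then show ?thesis using that y[of s] zk[of t] unfolding contributes_def by auto
  qed
  have "z (a + 1) \<noteq> z (a - k) \<or> z a \<noteq> z (a - k)" using ja by (auto simp: jump_def)
  then obtain t where t: "t \<in> {0, 1}" "z (a + 1 - t) \<noteq> z (a - k)"
    by (metis add_diff_cancel_right' diff_zero insertI1 insert_commute)
  \<comment> \<open>\<open>c a\<close> lies on \<open>e (a + 1 - t)\<close>, which differs from the common phase of both sources at \<open>a\<close>\<close>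
  have one: "z t = z (s - k) \<or> z k = - z s" if "s \<in> {0, 1}" for s
    using contributes t that by blast
  then have other: "z (1 - t) = z (s - k) \<or> z k = - z s" if "s \<in> {0, 1}" for s
    using non_jump_transfer[OF k w jw t(1)] that by blast
  have all: "z t' = z (s - k) \<or> z k = - z s" if "s \<in> {0, 1}" "t' \<in> {0, 1}" for s t'
  proof -
    have "t' = t \<or> t' = 1 - t" using t(1) that by auto
    then show ?thesis using one other that(1) by blast
  qed
  have "z 1 \<noteq> z 0" using \<open>jump 0\<close> by (simp add: jump_def)
  then have "z k = - z 0" "z k = - z 1" using all[of 0 0] all[of 0 1] all[of 1 0] all[of 1 1] by auto
  then show False using \<open>z 1 \<noteq> z 0\<close> by simp
qed

text \<open>
  The balance is a signed sum of the terms classified by \<open>alive\<close>. It cannot be zero at a point where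
  exactly one of them is not.
\<close>

lemma two_valued_isolated:
  assumes vals: "\<And>v. v \<in> {0..<int n} \<Longrightarrow> z v = (if v \<in> S then - z 0 else z 0)"
    and alive: "survivors n S q = [p]"
  shows False
proof -
  define \<beta> where "\<beta> = (\<lambda>u. u mod int n \<in> S)"
  have two: "z u = (if \<beta> u then - z 0 else z 0)" for u
    using vals[of "u mod int n"] n_pos by (simp add: \<beta>_def z_mod)
  obtain \<gamma> where \<gamma>: "generic \<gamma>" using generic_pair by blast
  define c where "c u = (case q u of None \<Rightarrow> \<gamma> | Some b \<Rightarrow> e 0 + (if b then pi / 2 else 0))" for u
  have b0: "\<not> \<beta> 0" using two[of 0] by (auto split: if_splits)
  have zz: "z u = z v \<longleftrightarrow> \<beta> u = \<beta> v" "z u = - z v \<longleftrightarrow> \<beta> u \<noteq> \<beta> v" for u v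
    using two[of u] two[of v] by auto
  have dc: "dir (c u) = z v \<longleftrightarrow> q u = Some (\<beta> v)" "dir (c u) = - z v \<longleftrightarrow> q u = Some (\<not> \<beta> v)" for u v
  proof -
    have "dir (c u) = (if b then - z 0 else z 0)" if "q u = Some b" for b
      using that by (auto simp: c_def z_def)
    moreover have "dir (c u) \<noteq> z v" "dir (c u) \<noteq> - z v" if "q u = None"
      using that \<gamma> by (auto simp: c_def generic_def)
    ultimately show "dir (c u) = z v \<longleftrightarrow> q u = Some (\<beta> v)"
      "dir (c u) = - z v \<longleftrightarrow> q u = Some (\<not> \<beta> v)"
      using two[of v] by (cases "q u"; auto)+
  qed
  define T where "T k t s = sin (e t - e (s - k)) * slope n e t k c * source n e s k c" for k t s
  have T: "T k t s = 0 \<longleftrightarrow> \<not> alive n S q k t s" for k t s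
  proof -
    have "sin (e t - e (s - k)) = 0 \<longleftrightarrow> \<beta> t = \<beta> (s - k)"
      unfolding zz(1)[symmetric] by (simp add: z_def dir_diff)
    then show ?thesis
      unfolding T_def mult_eq_0_iff slope_zero_iff source_zero_iff dc alive_def Let_def
      by (auto simp: \<beta>_def)
  qed
  obtain k t s where p: "p = (k, t, s)" by (cases p)
  have only: "alive n S q k' t' s' \<longleftrightarrow> (k', t', s') = p"
    if "k' \<in> I" "t' \<in> {0, 1}" "s' \<in> {0, 1}" for k' t' s'
  proof -
    have "(k', t', s') \<in> set (survivors n S q) \<longleftrightarrow> (k', t', s') \<in> set [p]"
      unfolding alive ..
    then show ?thesis using that by (auto simp: survivors_def)
  qed
  have "p \<in> set (survivors n S q)" unfolding alive by simp
  then have kts: "k \<in> I" "t \<in> {0, 1}" "s \<in> {0, 1}" by (auto simp: p survivors_def)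
  have "0 = (\<Sum>j\<in>I. T j 0 0 - T j 0 1 - (T j 1 0 - T j 1 1))"
    using balance[of c] by (simp add: T_def drift_def algebra_simps)
  also have "\<dots> = (\<Sum>j\<in>{k}. T j 0 0 - T j 0 1 - (T j 1 0 - T j 1 1))"
  proof (rule sum.mono_neutral_right)
    show "\<forall>j\<in>I - {k}. T j 0 0 - T j 0 1 - (T j 1 0 - T j 1 1) = 0"
    proof
      fix j assume "j \<in> I - {k}"
      then have "T j t' s' = 0" if "t' \<in> {0, 1}" "s' \<in> {0, 1}" for t' s'
        using T only[of j t' s'] that p by auto
      then show "T j 0 0 - T j 0 1 - (T j 1 0 - T j 1 1) = 0" by simp
    qed
  qed (use kts in auto)
  finally have "T k 0 0 - T k 0 1 - (T k 1 0 - T k 1 1) = 0" by simp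
  moreover have "T k t' s' = 0 \<longleftrightarrow> (t', s') \<noteq> (t, s)" if "t' \<in> {0, 1}" "s' \<in> {0, 1}" for t' s'
    using T only[of k t' s'] kts(1) that p by auto
  ultimately show False using kts by force
qed

text \<open>
  The phase at \<open>r + 1\<close>, the fixed offset of \<open>d \<mapsto> 1 - d\<close>, is the only one off the direction of \<open>e 0\<close>.
  It is not orthogonal to \<open>e 0\<close>, so that all coordinates but the one at \<open>r\<close> can be placed
  orthogonally to \<open>e 0\<close>: this kills every term away from \<open>r\<close> and no factor of the term at \<open>r\<close>.
\<close>

lemma lone_exception:
  assumes n: "int n = 2 * r + 1" "r \<ge> 2"
    and others: "\<And>u. u \<in> {0..<int n} - {r + 1} \<Longrightarrow> z u = z 0"
    and "z (r + 1) \<noteq> z 0" "z (r + 1) \<noteq> - z 0"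
  shows False
proof -
  let ?B = "z (r + 1)"
  have vals: "z u \<in> {z 0, ?B}" for u
    using others[of "u mod int n"] z_mod[of u] n_pos by (cases "u mod int n = r + 1") auto
  \<comment> \<open>orthogonal to \<open>e 0\<close> kills every source away from \<open>r\<close>; the choice at \<open>r\<close> kills the second slope there\<close>
  define c where "c u = (if u = r then e (r + 1) + pi / 2 else e 0 + pi / 2)" for u
  have cr: "dir (c r) = - ?B" and cu: "\<And>u. u \<noteq> r \<Longrightarrow> dir (c u) = - z 0"
    by (simp_all add: c_def z_def)
  have rI: "r \<in> I" and z1: "z 1 = z 0" "z r = z 0" using n others[of 1] others[of r] by auto
  have neq: "- z 0 \<noteq> z u" "dir (c r) \<noteq> - z 0" for u
    using vals[of u] assms(4,5) cr by auto
  have car: "source n e s j c = 0" if "j \<noteq> r" "s \<in> {0, 1}" for j s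
    using that cu z1 by (auto simp: source_zero_iff)
  have "drift n e 0 r c = 0"
  proof (rule isolated_drift)
    show "slope n e 0 r c \<noteq> 0"
      unfolding slope_zero_iff using cu neq z1 by auto
    show "slope n e 0 j c * drift n e 0 j c = 0" if "j \<in> I - {r}" for j
      using car that by (simp add: drift_def)
    show "slope n e (1 - 0) j c * drift n e (1 - 0) j c = 0" if "j \<in> I" for j
    proof (cases "j = r")
      case True
      then show ?thesis using cr by (simp add: slope_zero_iff)
    qed (use car in \<open>simp add: drift_def\<close>)
  qed (use rI in auto)
  moreover have "z (- r) = ?B" using z_period[of "- r"] n by (simp add: algebra_simps)
  moreover have "z (1 - r) = z 0"
    using z_period[of "1 - r"] n others[of "r + 2"] by (simp add: algebra_simps)
  moreover have "source n e 0 r c \<noteq> 0"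
    unfolding source_zero_iff using cu neq by auto
  moreover have "sin (e 0 - e u) = 0 \<longleftrightarrow> z 0 = z u" for u by (simp add: z_def dir_diff)
  ultimately show False using assms(4) unfolding drift_def
    by (metis diff_zero mult_eq_0_iff mult_zero_left)
qed

end

section \<open>Dimensions five and seven\<close>

text \<open>
  Two coordinates at most have to be placed to leave one term of each pattern that remains below.
\<close>

lemma survivors_five:
  "survivors 5 {3} [2 \<mapsto> False] = [(2, 0, 0)]"
  "survivors 5 {2, 4} [1 \<mapsto> False] = [(1, 0, 0)]"
  "survivors 5 {2, 3, 4} [1 \<mapsto> True] = [(2, 0, 1)]"
  by code_simp+

lemma survivors_seven:
  "survivors 7 {4} [3 \<mapsto> False] = [(3, 0, 0)]"
  "survivors 7 {3, 4, 5} [1 \<mapsto> True, 2 \<mapsto> True] = [(3, 0, 1)]"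
  "survivors 7 {2, 3, 4, 5, 6} [1 \<mapsto> True] = [(2, 0, 1)]"
  "survivors 7 {2, 3, 4, 6} [1 \<mapsto> True, 3 \<mapsto> False] = [(2, 0, 1)]"
  "survivors 7 {2, 4, 5, 6} [1 \<mapsto> False, 2 \<mapsto> True] = [(3, 1, 1)]"
  "survivors 7 {2, 6} [1 \<mapsto> False] = [(1, 0, 0)]"
  "survivors 7 {2, 4, 6} [1 \<mapsto> False] = [(1, 0, 0)]"
  by code_simp+

context balanced_phases
begin

text \<open>
  If 0 is a jump then all positions are. The pair rules make the phases alternate around 0 with
  \<open>e 1\<close> orthogonal to \<open>e 0\<close>, which an odd cycle cannot sustain. If 0 is not a jump, the pair rules
  leave three two-valued patterns and the lone exception.
\<close>

lemma all_equal_five: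
  assumes n: "n = 5"
  shows "z u = z 0"
proof (rule ccontr)
  assume "z u \<noteq> z 0"
  then have nconst: "\<not> (\<forall>u. z u = z 0)" by blast
  have I: "I = {1, 2, 3, 4}" and range: "{0..<int n} = {0, 1, 2, 3, 4}" using n by auto
  have per: "z 5 = z 0" "z 6 = z 1" "z 7 = z 2" "z (-1) = z 4" "z (-2) = z 3" "z (-3) = z 2" "z (-4) = z 1"
    using z_period[of 0] z_period[of 1] z_period[of 2] z_minus_period[of 4] z_minus_period[of 3]
      z_minus_period[of 2] z_minus_period[of 1] n by simp_all
  have j: "jump 0 \<longleftrightarrow> z 1 \<noteq> z 0" "jump 1 \<longleftrightarrow> z 2 \<noteq> z 1" "jump 2 \<longleftrightarrow> z 3 \<noteq> z 2"
    "jump 3 \<longleftrightarrow> z 4 \<noteq> z 3" "jump 4 \<longleftrightarrow> z 0 \<noteq> z 4" "jump (-1) \<longleftrightarrow> z 0 \<noteq> z 4"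
    using per by (simp_all add: jump_def)
  note step = step_two_rule[unfolded n I, simplified]
    and step' = step_two_rule'[unfolded n I, simplified]
    and adj = adjacent_jumps_rule[unfolded n I, simplified]
    and adj' = adjacent_jumps_rule'[unfolded n I, simplified]
  show False
  proof (cases "jump 0")
    case True
    have all: "jump u" for u using jump_everywhere[of u] True n by simp
    then have ne: "z 1 \<noteq> z 0" "z 2 \<noteq> z 1" "z 3 \<noteq> z 2" "z 4 \<noteq> z 3" "z 0 \<noteq> z 4" using j by auto
    have 1: "z 2 = z 0 \<or> z 4 = - z 1" using adj[of 1 2] all per by auto
    have 2: "z 4 = z 1 \<or> z 2 = - z 0" using adj'[of 2 3] all per by auto
    have 3: "z 1 = - z 0"
    proof (rule ccontr)
      assume "z 1 \<noteq> - z 0"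
      then have "z 3 = z 1 \<or> z 4 = z 2" "z 3 = z 1 \<or> z 0 = z 3" "z 4 = z 2 \<or> z 0 = z 3"
        using step[of 1 2] step[of 1 3] step[of 2 3] all per by auto
      then show False using 1 2 ne by (metis minus_minus z_simps(1))
    qed
    then have d: "z 2 = z 0" "z 4 = z 1" using 1 2 ne by auto
    have "z 1 = z (0 - 2) \<or> z (2 + 1) = - z 0 \<or> z (3 + 1 - 1) = z (3 - 2 + 0) \<or> z (4 + 1 - 1) = z (4 - 2 + 0)"
      by (rule all_jumps_rule[where w = 1]) (use all I in auto)
    then have "z 1 = z 3 \<or> z 3 = - z 0 \<or> z 3 = z 1 \<or> z 4 = z 2" using per by simp
    then show False using ne d 3 by metis
  next
    case False
    then have z1: "z 1 = z 0" using j by simp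
    have X: "z k = - z 0 \<or> z (- k) = z 0 \<and> z (1 - k) = z 0" if "k \<in> {1, 2, 3, 4}" "\<not> jump k" for k
      using non_jump_position[OF False nconst] that I by blast
    have X1: "z 2 = z 0 \<Longrightarrow> z 4 = z 0" using X[of 1] j z1 per by simp
    have X4: "z 4 = z 0 \<Longrightarrow> z 2 = z 0" using X[of 4] j per by simp
    show False
    proof (cases "z 2 = z 0")
      case True
      then have z4: "z 4 = z 0" by (rule X1)
      have z3: "z 3 \<noteq> z 0"
      proof
        assume "z 3 = z 0"
        then have "z v = z 0" if "v \<in> {0..<int n}" for v using that True z4 z1 unfolding range by auto
        then show False using nconst z_mod n_pos by (metis atLeastLessThan_iff of_nat_0_less_iff pos_mod_bound pos_mod_sign)
      qed
      show False
      proof (cases "z 3 = - z 0")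
        case True
        show False
          by (rule two_valued_isolated[OF _ survivors_five(1)[folded n]], unfold range)
            (use True \<open>z 2 = z 0\<close> z4 z1 in auto)
      next
        case False
        show False
          by (rule lone_exception[of 2, unfolded range]) (use n False z3 \<open>z 2 = z 0\<close> z4 z1 in auto)
      qed
    next
      case z2: False
      then have z4: "z 4 \<noteq> z 0" using X4 by blast
      then have j1: "jump 1" "jump 4" "jump (-1)" using j z1 z2 by auto
      show False
      proof (cases "z 3 = z 0")
        case True
        then have "jump 2" "jump 3" using z2 z4 j by auto
        then have "z 4 = - z 0" "z 2 = - z 0"
          using adj[of 1 2] adj'[of 3 4] z2 z4 z1 per j1 by force+
        then show False
          by (intro two_valued_isolated[OF _ survivors_five(2)[folded n]], unfold range)
            (use True z1 in auto)
      next
        case z3: False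
        then have "\<not> jump 3" "\<not> jump 2"
          using step[of 1 3] step'[of 4 2] j1 z1 per by auto
        then have "z 4 = z 3" "z 2 = z 3" using j by auto
        moreover have "z 3 = - z 0" using X[of 3] \<open>\<not> jump 3\<close> per z2 by auto
        ultimately show False
          by (intro two_valued_isolated[OF _ survivors_five(3)[folded n]], unfold range)
            (use z1 in auto)
      qed
    qed
  qed
qed

text \<open>
  The argument is that of \<open>all_equal_five\<close>; positions 3, 4 and 5 are now free and are settled in the
  order 3, 5, 4 when 0 is a jump, and by the pair rules at 1 and 6 otherwise.
\<close>

lemma all_equal_seven:
  assumes n: "n = 7"
  shows "z u = z 0"
proof (rule ccontr)
  assume "z u \<noteq> z 0"
  then have nconst: "\<not> (\<forall>u. z u = z 0)" by blast
  have I: "I = {1, 2, 3, 4, 5, 6}" and range: "{0..<int n} = {0, 1, 2, 3, 4, 5, 6}" using n by auto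
  have per: "z 7 = z 0" "z 8 = z 1" "z 9 = z 2" "z (-1) = z 6" "z (-2) = z 5" "z (-3) = z 4"
    "z (-4) = z 3" "z (-5) = z 2" "z (-6) = z 1"
    using z_period[of 0] z_period[of 1] z_period[of 2] z_minus_period[of 6] z_minus_period[of 5]
      z_minus_period[of 4] z_minus_period[of 3] z_minus_period[of 2] z_minus_period[of 1] n by simp_all
  have j: "jump 0 \<longleftrightarrow> z 1 \<noteq> z 0" "jump 1 \<longleftrightarrow> z 2 \<noteq> z 1" "jump 2 \<longleftrightarrow> z 3 \<noteq> z 2"
    "jump 3 \<longleftrightarrow> z 4 \<noteq> z 3" "jump 4 \<longleftrightarrow> z 5 \<noteq> z 4" "jump 5 \<longleftrightarrow> z 6 \<noteq> z 5"
    "jump 6 \<longleftrightarrow> z 0 \<noteq> z 6" "jump (-1) \<longleftrightarrow> z 0 \<noteq> z 6"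
    using per by (simp_all add: jump_def)
  note step = step_two_rule[unfolded n I, simplified]
    and step' = step_two_rule'[unfolded n I, simplified]
    and adj = adjacent_jumps_rule[unfolded n I, simplified]
    and adj' = adjacent_jumps_rule'[unfolded n I, simplified]
    and three = step_three_rule[unfolded n I, simplified]
  show False
  proof (cases "jump 0")
    case True
    have all: "jump u" for u using jump_everywhere[of u] True n by simp
    then have ne: "z 1 \<noteq> z 0" "z 2 \<noteq> z 1" "z 3 \<noteq> z 2" "z 4 \<noteq> z 3" "z 5 \<noteq> z 4" "z 6 \<noteq> z 5" "z 0 \<noteq> z 6"
      using j by auto
    have 1: "z 2 = z 0 \<or> z 6 = - z 1" using adj[of 1 2] all per by auto
    have 2: "z 6 = z 1 \<or> z 2 = - z 0" using adj'[of 2 3] all per by auto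
    have 3: "z 1 = - z 0"
    proof (rule ccontr)
      assume "z 1 \<noteq> - z 0"
      then have "z (a + 2) = z a \<or> z (b + 2) = z b" if "a \<in> {1..5}" "b \<in> {1..5}" "a \<noteq> b" for a b
        using step[of a b] all that by auto
      from this[of 1 2] this[of 1 3] this[of 1 4] this[of 1 5] this[of 2 3] this[of 2 4] this[of 2 5]
        this[of 3 4] this[of 3 5] this[of 4 5]
      have "z 3 = z 1 \<or> z 4 = z 2" "z 3 = z 1 \<or> z 5 = z 3" "z 3 = z 1 \<or> z 6 = z 4" "z 3 = z 1 \<or> z 0 = z 5"
        "z 4 = z 2 \<or> z 5 = z 3" "z 4 = z 2 \<or> z 6 = z 4" "z 4 = z 2 \<or> z 0 = z 5"
        "z 5 = z 3 \<or> z 6 = z 4" "z 5 = z 3 \<or> z 0 = z 5" "z 6 = z 4 \<or> z 0 = z 5"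
        using per by simp_all
      then show False using 1 2 ne by (metis minus_minus z_simps(1))
    qed
    then have d: "z 2 = z 0" "z 6 = z 1" using 1 2 ne by auto
    have R: "z t = z (s - k) \<or> z (k + t) = - z s \<or> z (a + 1 - t) = z (a - k + s)
       \<or> z (b + 1 - t) = z (b - k + s)"
      if "t \<in> {0, 1}" "s \<in> {0, 1}" "k \<in> I" "a \<in> I - {k}" "b \<in> I - {k}" "a \<noteq> b"
        "w \<in> I - {k, a, b}" for t s k a b w
      by (rule all_jumps_rule[OF all, where w = w]) (use that in auto)
    have z3: "z 3 = z 1"
    proof (rule ccontr)
      assume "z 3 \<noteq> z 1"
      moreover have "z 1 = z 5 \<or> z 3 = - z 0 \<or> z 3 = z 1 \<or> z 4 = z 2"
        using R[of 1 0 2 3 4 1] per I by simp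
      moreover have "z 1 = z 5 \<or> z 3 = - z 0 \<or> z 3 = z 1 \<or> z 6 = z 4"
        using R[of 1 0 2 3 6 1] per I by simp
      ultimately show False using ne d 3 by metis
    qed
    have z5: "z 5 = z 0"
    proof (rule ccontr)
      assume "z 5 \<noteq> z 0"
      moreover have "z 0 = z 3 \<or> z 5 = - z 1 \<or> z 5 = z 0 \<or> z 2 = z 4"
        using R[of 0 1 5 4 1 2] per I by simp
      moreover have "z 0 = z 3 \<or> z 5 = - z 1 \<or> z 5 = z 0 \<or> z 4 = z 6"
        using R[of 0 1 5 4 3 2] per I by simp
      ultimately show False using ne d 3 z3 by (metis minus_minus)
    qed
    have "z 1 = z 4 \<or> z 4 = - z 0 \<or> z 1 = z 5 \<or> z 2 = z 6"
      using R[of 1 0 3 1 2 4] per I by simp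
    then show False using ne d 3 z3 z5 by metis
  next
    case False
    then have z1: "z 1 = z 0" using j by simp
    have X: "z k = - z 0 \<or> z (- k) = z 0 \<and> z (1 - k) = z 0" if "k \<in> {1, 2, 3, 4, 5, 6}" "\<not> jump k" for k
      using non_jump_position[OF False nconst] that I by blast
    have X1: "z 2 = z 0 \<Longrightarrow> z 6 = z 0" using X[of 1] j z1 per by simp
    have X6: "z 6 = z 0 \<Longrightarrow> z 2 = z 0" using X[of 6] j per by simp
    have X2: "z 3 = z 2 \<Longrightarrow> z 2 = - z 0 \<or> z 5 = z 0 \<and> z 6 = z 0" using X[of 2] j per by simp
    have X3: "z 4 = z 3 \<Longrightarrow> z 3 = - z 0 \<or> z 4 = z 0 \<and> z 5 = z 0" using X[of 3] j per by simp
    have X4: "z 5 = z 4 \<Longrightarrow> z 4 = - z 0 \<or> z 3 = z 0 \<and> z 4 = z 0" using X[of 4] j per by simp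
    have X5: "z 6 = z 5 \<Longrightarrow> z 5 = - z 0 \<or> z 2 = z 0 \<and> z 3 = z 0" using X[of 5] j per by simp
    show False
    proof (cases "z 2 = z 0")
      case z2: True
      then have z6: "z 6 = z 0" by (rule X1)
      have z35: "z 3 = z 0 \<longleftrightarrow> z 5 = z 0" using X2 X5 z2 z6 by (metis z_simps(1))
      show False
      proof (cases "z 3 = z 0")
        case z3: True
        have z4: "z 4 \<noteq> z 0"
        proof
          assume "z 4 = z 0"
          then have "z v = z 0" if "v \<in> {0..<int n}" for v
            using that z1 z2 z3 z35 z6 unfolding range by auto
          then show False using nconst z_mod n_pos
            by (metis atLeastLessThan_iff of_nat_0_less_iff pos_mod_bound pos_mod_sign)
        qed
        show False
        proof (cases "z 4 = - z 0")
          case True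
          show False
            by (rule two_valued_isolated[OF _ survivors_seven(1)[folded n]], unfold range)
              (use True z1 z2 z3 z35 z6 in auto)
        next
          case False
          show False
            by (rule lone_exception[of 3, unfolded range]) (use n False z1 z2 z3 z35 z4 z6 in auto)
        qed
      next
        case z3: False
        then have j2: "jump 2" using j z2 by simp
        have "\<not> jump 3" using three[of 2 3] j2 z1 z2 z3 z6 z35 per by auto
        then have z43: "z 4 = z 3" using j by simp
        have "\<not> jump 4" using three[of 2 4] j2 z1 z2 z3 z6 z35 z43 per by auto
        then have z54: "z 5 = z 4" using j by simp
        have "z 3 = - z 0" using X3 z43 z3 z35 by blast
        then show False
          by (intro two_valued_isolated[OF _ survivors_seven(2)[folded n]], unfold range)
            (use z1 z2 z43 z54 z6 in auto)
      qed
    next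
      case z2: False
      then have z6: "z 6 \<noteq> z 0" using X6 by blast
      have j1: "jump 1" and j6: "jump 6" "jump (-1)" using z1 z2 z6 j by auto
      have S: "z (a + 2) = z a \<or> z (b + 2) = z b"
        if "a \<in> {1..5}" "b \<in> {1..5}" "a \<noteq> b" "jump a" "jump b" for a b
        using step[of a b] that j1 z1 by auto
      have S': "z (a + 1) = z (a - 1) \<or> z (b + 1) = z (b - 1)"
        if "a \<in> {2..6}" "b \<in> {2..6}" "a \<noteq> b" "jump a" "jump b" for a b
        using step'[of a b] that j6 z1 by auto
      \<comment> \<open>1 and 6 are jumps with partners 3 and 5 at distance two; a partner off \<open>e 0\<close> settles all other jumps\<close>
      consider "z 3 \<noteq> z 0" "z 5 \<noteq> z 0" | "z 3 \<noteq> z 0" "z 5 = z 0" | "z 3 = z 0" "z 5 \<noteq> z 0"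
        | "z 3 = z 0" "z 5 = z 0" by blast
      then show False
      proof cases
        case 1
        have z65: "z 6 = z 5" using S[of 1 5] 1 j j1 z1 per by auto
        have z32: "z 3 = z 2" using S'[of 6 2] 1 j j6 z1 per by auto
        have z2': "z 2 = - z 0" using X2[OF z32] z6 by blast
        have z5': "z 5 = - z 0" using X5[OF z65] z2 by blast
        have "z 4 = z 3"
          using S[of 1 4] 1 j j1 z1 per z65 z32 z2' z5' by auto
        then show False
          by (intro two_valued_isolated[OF _ survivors_seven(3)[folded n]], unfold range)
            (use z1 z2' z5' z65 z32 in auto)
      next
        case 2
        have "z 5 \<noteq> z 4" using X4 2 by (metis z_simps(1))
        then have z64: "z 6 = z 4" using S[of 1 4] 2 j j1 z1 per by auto
        have z43: "z 4 = z 3" using S[of 1 3] 2 j j1 z1 per by auto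
        have z3': "z 3 = - z 0" using X3[OF z43] 2 z43 by metis
        have "z 3 = z 2" using S[of 1 2] 2 j j1 z1 per z43 by auto
        then show False
          by (intro two_valued_isolated[OF _ survivors_seven(4)[folded n]], unfold range)
            (use z1 2 z3' z43 z64 in auto)
      next
        case 3
        have "z 4 \<noteq> z 3" using X3 3 by (metis z_simps(1))
        then have z42: "z 4 = z 2" using S'[of 6 3] 3 j j6 z1 per by auto
        have z54: "z 5 = z 4" using S'[of 6 4] 3 j j6 z1 per by auto
        have z4': "z 4 = - z 0" using X4[OF z54] 3 z54 by metis
        have "z 6 = z 5" using S'[of 6 5] 3 j j6 z1 per z54 by auto
        then show False
          by (intro two_valued_isolated[OF _ survivors_seven(5)[folded n]], unfold range)
            (use z1 3 z4' z42 z54 in auto)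
      next
        case 4
        then have j25: "jump 2" "jump 5" using j z2 z6 by auto
        show False
        proof (cases "z 4 = z 0")
          case True
          have "z 6 = - z 0" "z 2 = - z 0"
            using adj[of 1 5] adj'[of 2 6] j25 j1 j6 z1 z2 z6 per by force+
          then show False
            by (intro two_valued_isolated[OF _ survivors_seven(6)[folded n]], unfold range)
              (use z1 4 True in auto)
        next
          case False
          then have j34: "jump 3" "jump 4" using j 4 by auto
          have z6': "z 6 = - z 0" and z2': "z 2 = - z 0"
            using adj[of 1 2] adj'[of 3 4] j25 j34 j1 j6 z1 z2 z6 per by force+
          moreover have "z 4 = - z 0" using S[of 2 4] j25 j34 z6' z2' by auto
          ultimately show False
            by (intro two_valued_isolated[OF _ survivors_seven(7)[folded n]], unfold range)
              (use z1 4 in auto)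
        qed
      qed
    qed
  qed
qed

end

lemma reduction_balanced:
  assumes red: "\<And>y. mean_convection n e y n = 0" and n: "n > 0" and per: "\<And>m. e (m + int n) = e m"
  shows "balanced_phases n e"
proof
  fix c :: "int \<Rightarrow> real"
  define y where "y u = pi / 2 - c (int u)" for u
  define c' where "c' d = pi / 2 - y (cyc n (int n + d))" for d
  have c': "c' d = c d" if "d \<in> {1..<int n}" for d
  proof -
    have "cyc n (int n + d) = nat d"
    proof -
      have "(int n + d - 1) mod int n = (d - 1) mod int n"
        by (metis add_diff_eq mod_add_self1)
      also have "\<dots> = d - 1" using that by (intro mod_pos_pos_trivial) auto
      finally show ?thesis by (simp add: cyc_def)
    qed
    then show ?thesis using that by (simp add: c'_def y_def)
  qed
  have "slope n e t k c' = slope n e t k c" "source n e t k c' = source n e t k c"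
    if "k \<in> {1..<int n}" for t k
    unfolding slope_def source_def using c' that by (auto intro!: prod.cong arg_cong2[where f = "(*)"])
  then have "(\<Sum>k\<in>{1..<int n}. slope n e 0 k c * drift n e 0 k c - slope n e 1 k c * drift n e 1 k c)
      = (\<Sum>k\<in>{1..<int n}. slope n e 0 k c' * drift n e 0 k c' - slope n e 1 k c' * drift n e 1 k c')"
    unfolding drift_def by (intro sum.cong) auto
  also have "\<dots> = 0"
    using mean_convection_eq_balance[of n n e c' y] n per red[of y] by (simp add: c'_def)
  finally show "(\<Sum>k\<in>{1..<int n}. slope n e 0 k c * drift n e 0 k c - slope n e 1 k c * drift n e 1 k c) = 0" .
qed (use n per in \<open>simp_all\<close>)

text \<open>
  Phases that agree modulo \<open>\<pi>\<close> change each factor only by a sign. The shift permutes the offsets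
  cyclically, so both waves collect the same product of signs.
\<close>

lemma vfield_zero_of_equal_dirs:
  assumes per: "\<And>m. e (m + int n) = e m" and dirs: "\<And>m. dir (e m) = dir (e 0)" and i: "i \<in> {1..n}"
  shows "vfield n e y i = 0"
proof -
  have "\<exists>r::int. e m = e 0 + r * pi" for m
  proof -
    have "sin (e m - e 0) = 0" using dirs[of m] by (simp add: dir_diff)
    then obtain r :: int where "e m - e 0 = r * pi" using sin_zero_iff_int2 by blast
    then have "e m = e 0 + r * pi" by simp
    then show ?thesis ..
  qed
  then obtain r :: "int \<Rightarrow> int" where r: "\<And>m. e m = e 0 + of_int (r m) * pi" by metis
  define h where "h m = cos (of_int (r m) * pi)" for m
  have sn: "sin (of_int (r m) * pi) = 0" for m by (simp add: mult.commute sin_zero_iff_int2) 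
  have c: "cos (x + e m) = h m * cos (x + e 0)" and s: "sin (x + e m) = h m * sin (x + e 0)" for x m
    using sn[of m] by (simp_all add: r[of m] h_def add.assoc[symmetric] cos_add[of "x + e 0"] sin_add[of "x + e 0"])
  have hper: "h (m + int n) = h m" for m
  proof -
    have "of_int (r (m + int n)) * pi = of_int (r m) * pi" using r[of m] r[of "m + int n"] per[of m] by simp
    then show ?thesis by (simp add: h_def)
  qed
  have wave: "wave n (\<lambda>m. e (m + t)) y i
      = h t * (\<Prod>u\<in>{1..n} - {i}. h (int u - int i + t)) * (sin (y i + e 0) * (\<Prod>u\<in>{1..n} - {i}. cos (y u + e 0)))" for t
    unfolding wave_def by (simp add: c[of _ "_ + _"] s[of _ "0 + _"] s[of _ t] prod.distrib)
  have total: "h t * (\<Prod>u\<in>{1..n} - {i}. h (int u - int i + t)) = (\<Prod>d\<in>{0..<int n}. h (d + t))" for t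
  proof -
    have n: "n > 0" using i by auto
    have em: "h a = h b" if "a mod int n = b mod int n" for a b
      using periodic_mod[of h n, OF hper] that by metis
    have "(\<Prod>u\<in>{1..n} - {i}. h (int u - int i + t)) = (\<Prod>d\<in>{1..<int n}. h (int (cyc n (int i + d)) - int i + t))"
      by (rule prod.reindex_bij_betw[OF cyc_offsets_bij[OF i], symmetric])
    also have "\<dots> = (\<Prod>d\<in>{1..<int n}. h (d + t))"
    proof (rule prod.cong[OF refl])
      fix d
      show "h (int (cyc n (int i + d)) - int i + t) = h (d + t)"
      proof (rule em)
        have "(int (cyc n (int i + d)) - int i + t) mod int n = ((int i + d) - int i + t) mod int n"
          by (intro mod_add_cong mod_diff_cong cyc_mod[OF n] refl)
        then show "(int (cyc n (int i + d)) - int i + t) mod int n = (d + t) mod int n" by simp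
      qed
    qed
    finally have "(\<Prod>u\<in>{1..n} - {i}. h (int u - int i + t)) = (\<Prod>d\<in>{1..<int n}. h (d + t))" .
    moreover have "{0..<int n} = insert 0 {1..<int n}" using n by auto
    ultimately show ?thesis by simp
  qed
  have "(\<Prod>d\<in>{0..<int n}. h (d + 1)) = (\<Prod>d\<in>{1..<int n + 1}. h d)"
    by (rule prod.reindex_bij_witness[of _ "\<lambda>d. d - 1" "\<lambda>d. d + 1"]) auto
  also have "\<dots> = (\<Prod>d\<in>{0..<int n}. h d)"
  proof -
    have "{1..<int n + 1} = insert (int n) {1..<int n}" "{0..<int n} = insert 0 {1..<int n}" using i by auto
    then show ?thesis using hper[of 0] by simp
  qed
  finally have "(\<Prod>d\<in>{0..<int n}. h (d + 1)) = (\<Prod>d\<in>{0..<int n}. h (d + 0))" by simp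
  then show ?thesis using wave[of 0] wave[of 1] total[of 0] total[of 1] by (simp add: vfield_def)
qed

lemma vanishing_of_reduction:
  assumes "n = 5 \<or> n = 7" "\<alpha> > 0" "vr > 0" "reduction_condition n \<alpha> vr \<xi>"
  shows "vel_vanishes n \<alpha> vr \<xi>"
proof -
  have n: "n \<ge> 2" "n > 0" using assms(1) by auto
  interpret balanced_phases n "phase n \<xi>"
    by (rule reduction_balanced) (use assms n reduction_iff[of n \<alpha> vr \<xi>] phase_period in auto)
  have "z m = z 0" for m using all_equal_five all_equal_seven assms(1) by blast
  then show ?thesis
    using vfield_zero_of_equal_dirs[of "phase n \<xi>" n] phase_period n assms
    by (simp add: vel_vanishes_iff z_def)
qed

section \<open>Alternating phases in even dimension\<close>

text \<open>
  Seen from offset \<open>k\<close>, alternating phases look as from offset 0, with the two values exchanged if \<open>k\<close>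
  is odd. For even \<open>k\<close> sources and slopes coincide, each drift is the same multiple of the other
  wave's source, and the difference of products cancels by symmetry. For odd \<open>k\<close> each drift
  is the same multiple of the wave's own source, and source times slope is equal for both waves.
\<close>

lemma alternating_balance:
  assumes alt: "\<And>m. e (m + 2) = e m"
  shows "(\<Sum>k\<in>{1..<int n}. slope n e 0 k c * drift n e 0 k c - slope n e 1 k c * drift n e 1 k c) = 0"
proof (rule sum.neutral, rule ballI)
  fix k
  have em: "e a = e b" if "even (a - b)" for a b
  proof -
    have "a mod int 2 = b mod int 2" using that by (simp add: mod_eq_dvd_iff)
    then show ?thesis using periodic_mod[of e 2] alt by (metis of_nat_numeral)
  qed
  show "slope n e 0 k c * drift n e 0 k c - slope n e 1 k c * drift n e 1 k c = 0"
  proof (cases "even k")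
    case True
    have "e (k + t) = e t" "e (u - k + t) = e (u + t)" for t u
      using True by (intro em; simp)+
    then have "slope n e t k c = source n e t k c" for t
      by (simp add: slope_def source_def)
    moreover have "e (- k) = e 0" "e (1 - k) = e 1" using True by (intro em; simp)+
    moreover have "sin (e 1 - e 0) = - sin (e 0 - e 1)" using sin_minus[of "e 0 - e 1"] by simp
    ultimately show ?thesis by (simp add: drift_def)
  next
    case False
    have "e k = e 1" "e (k + 1) = e 0" "e (u - k) = e (u + 1)" "e (u - k + 1) = e u" for u
      using False by (intro em; simp)+
    then have "slope n e 0 k c = cos (c k - e 1) * (\<Prod>u\<in>{1..<int n} - {k}. sin (c u - e u))"
      "source n e 1 k c = cos (c k - e 1) * (\<Prod>u\<in>{1..<int n} - {k}. sin (c u - e u))"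
      "slope n e 1 k c = cos (c k - e 0) * (\<Prod>u\<in>{1..<int n} - {k}. sin (c u - e (u + 1)))"
      "source n e 0 k c = cos (c k - e 0) * (\<Prod>u\<in>{1..<int n} - {k}. sin (c u - e (u + 1)))"
      by (simp_all add: slope_def source_def)
    moreover have "e (- k) = e 1" "e (1 - k) = e 0" using False by (intro em; simp)+
    moreover have "sin (e 1 - e 0) = - sin (e 0 - e 1)" using sin_minus[of "e 0 - e 1"] by simp
    ultimately show ?thesis by (simp add: drift_def)
  qed
qed

lemma phase_sym:
  assumes "even n" "n > 0"
  shows "phase n sym_phase m = (if even m then - pi / 4 else pi / 4)"
proof -
  have "even (m mod int n) \<longleftrightarrow> even m"
    using assms(1) by (simp add: dvd_mod_iff)
  moreover have "nat (m mod int n) + 1 = 1 \<longleftrightarrow> m mod int n = 0"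
    using pos_mod_sign[of "int n" m] assms(2) by (simp add: order.antisym)
  ultimately show ?thesis by (auto simp: phase_def sym_phase_def)
qed

lemma sym_phase_reduction:
  assumes "even n" "n \<ge> 2" "\<alpha> > 0" "vr > 0"
  shows "reduction_condition n \<alpha> vr sym_phase"
  unfolding reduction_iff[OF assms(2-)]
proof (intro ballI allI)
  fix i y assume "i \<in> {1..n}"
  then show "mean_convection n (phase n sym_phase) y i = 0"
    using mean_convection_eq_balance[where c = "\<lambda>d. pi / 2 - y (cyc n (int i + d))" and e = "phase n sym_phase"]
      phase_period alternating_balance[of "phase n sym_phase"] phase_sym[of n] assms(1,2)
    by simp
qed

text \<open>
  After moving the origin to \<open>\<pi> / 4\<close> in each coordinate, the symmetric phases leave plain sines and
  cosines, collected in \<open>S\<close> and \<open>C\<close>. A quarter-period translation replaces \<open>(S u, C u)\<close> by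
  \<open>(C u, - S u)\<close>.
\<close>

definition twin :: "nat \<Rightarrow> (nat \<Rightarrow> real) \<Rightarrow> (nat \<Rightarrow> real) \<Rightarrow> nat \<Rightarrow> real" where
  "twin n S C i = S i * (\<Prod>u\<in>{1..n} - {i}. if even (u + i) then C u else - S u)
                - C i * (\<Prod>u\<in>{1..n} - {i}. if even (u + i) then - S u else C u)"

lemma vfield_sym:
  assumes "even n" "n > 0"
  shows "vfield n (phase n sym_phase) y i = twin n (\<lambda>u. sin (y u - pi / 4)) (\<lambda>u. cos (y u - pi / 4)) i"
proof -
  have q: "sin (x + pi / 4) = cos (x - pi / 4)" "cos (x + pi / 4) = - sin (x - pi / 4)" for x
  proof -
    have "x + pi / 4 = (x - pi / 4) + pi / 2" by simp
    then show "sin (x + pi / 4) = cos (x - pi / 4)" "cos (x + pi / 4) = - sin (x - pi / 4)"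
      by (simp_all only: sin_add cos_add sin_pi_half cos_pi_half, simp_all?)
  qed
  have p: "even (int u - int i) \<longleftrightarrow> even (u + i)" for u using even_diff[of "int u" "int i"] by simp
  have p': "even (int u - int i + 1) \<longleftrightarrow> odd (u + i)" for u using p[of u] by simp
  have "cos (y u + phase n sym_phase (int u - int i)) = (if even (u + i) then cos (y u - pi / 4) else - sin (y u - pi / 4))"
    "cos (y u + phase n sym_phase (int u - int i + 1)) = (if even (u + i) then - sin (y u - pi / 4) else cos (y u - pi / 4))" for u
    unfolding phase_sym[OF assms] p p' by (simp_all add: q)
  then show ?thesis
    unfolding vfield_def wave_def twin_def by (simp add: phase_sym[OF assms] q)
qed

lemma vfield_sym_advance:
  assumes "even n" "n > 0"
  defines "S \<equiv> \<lambda>y u. sin (y u - pi / 4)" and "C \<equiv> \<lambda>y u. cos (y u - pi / 4)"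
  shows "S (advance j y) = (S y)(j := C y j)" "C (advance j y) = (C y)(j := - S y j)"
proof -
  have "y j + pi / 2 - pi / 4 = (y j - pi / 4) + pi / 2" by simp
  then have "sin (y j + pi / 2 - pi / 4) = cos (y j - pi / 4)" "cos (y j + pi / 2 - pi / 4) = - sin (y j - pi / 4)"
    by (simp_all only: sin_add cos_add sin_pi_half cos_pi_half, simp_all?)
  then show "S (advance j y) = (S y)(j := C y j)" "C (advance j y) = (C y)(j := - S y j)"
    by (auto simp: S_def C_def advance_def)
qed

definition twin_jacobian :: "nat \<Rightarrow> (nat \<Rightarrow> real) \<Rightarrow> (nat \<Rightarrow> real) \<Rightarrow> nat \<Rightarrow> nat \<Rightarrow> real" where
  "twin_jacobian n S C i k = (\<Sum>j = 1..n.
      (let S' = S(k := C k); C' = C(k := - S k) in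
        twin n S' C' j * twin n (S(j := C j)) (C(j := - S j)) i
      + twin n S C j * twin n (S'(j := C' j)) (C'(j := - S' j)) i))"

lemma convection_jacobian_sym:
  assumes "even n" "n > 0"
  shows "convection_jacobian n (phase n sym_phase) y i k
       = twin_jacobian n (\<lambda>u. sin (y u - pi / 4)) (\<lambda>u. cos (y u - pi / 4)) i k"
  unfolding convection_jacobian_def twin_jacobian_def vfield_sym[OF assms] vfield_sym_advance[OF assms] Let_def
    fun_cong[OF vfield_sym_advance(1)[OF assms]] fun_cong[OF vfield_sym_advance(2)[OF assms]] ..

lemma interval_6: "{1..6::nat} = {1, 2, 3, 4, 5, 6}" by auto
lemma interval_8: "{1..8::nat} = {1, 2, 3, 4, 5, 6, 7, 8}" by auto
lemma interval_4: "{1..4::nat} = {1, 2, 3, 4}" by auto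

lemma twin_4:
  "twin 4 S C 1 = S 1 * S 2 * C 3 * S 4 + C 1 * C 2 * S 3 * C 4"
  "twin 4 S C 2 = S 2 * S 1 * S 3 * C 4 + C 2 * C 1 * C 3 * S 4"
  "twin 4 S C 3 = S 3 * C 1 * S 2 * S 4 + C 3 * S 1 * C 2 * C 4"
  "twin 4 S C 4 = S 4 * S 1 * C 2 * S 3 + C 4 * C 1 * S 2 * C 3"
  unfolding twin_def interval_4 by (simp_all add: insert_Diff_if del: One_nat_def)

lemma twin_6:
  "twin 6 S C 1 = - (S 1 * S 2 * C 3 * S 4 * C 5 * S 6 + C 1 * C 2 * S 3 * C 4 * S 5 * C 6)"
  "twin 6 S C 2 = - (S 2 * S 1 * S 3 * C 4 * S 5 * C 6 + C 2 * C 1 * C 3 * S 4 * C 5 * S 6)"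
  "twin 6 S C 3 = - (S 3 * C 1 * S 2 * S 4 * C 5 * S 6 + C 3 * S 1 * C 2 * C 4 * S 5 * C 6)"
  "twin 6 S C 4 = - (S 4 * S 1 * C 2 * S 3 * S 5 * C 6 + C 4 * C 1 * S 2 * C 3 * C 5 * S 6)"
  "twin 6 S C 5 = - (S 5 * C 1 * S 2 * C 3 * S 4 * S 6 + C 5 * S 1 * C 2 * S 3 * C 4 * C 6)"
  "twin 6 S C 6 = - (S 6 * S 1 * C 2 * S 3 * C 4 * S 5 + C 6 * C 1 * S 2 * C 3 * S 4 * C 5)"
  unfolding twin_def interval_6 by (simp_all add: insert_Diff_if del: One_nat_def)

lemma twin_8:
  "twin 8 S C 1 = S 1 * S 2 * C 3 * S 4 * C 5 * S 6 * C 7 * S 8 + C 1 * C 2 * S 3 * C 4 * S 5 * C 6 * S 7 * C 8"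
  "twin 8 S C 2 = S 2 * S 1 * S 3 * C 4 * S 5 * C 6 * S 7 * C 8 + C 2 * C 1 * C 3 * S 4 * C 5 * S 6 * C 7 * S 8"
  "twin 8 S C 3 = S 3 * C 1 * S 2 * S 4 * C 5 * S 6 * C 7 * S 8 + C 3 * S 1 * C 2 * C 4 * S 5 * C 6 * S 7 * C 8"
  "twin 8 S C 4 = S 4 * S 1 * C 2 * S 3 * S 5 * C 6 * S 7 * C 8 + C 4 * C 1 * S 2 * C 3 * C 5 * S 6 * C 7 * S 8"
  "twin 8 S C 5 = S 5 * C 1 * S 2 * C 3 * S 4 * S 6 * C 7 * S 8 + C 5 * S 1 * C 2 * S 3 * C 4 * C 6 * S 7 * C 8"
  "twin 8 S C 6 = S 6 * S 1 * C 2 * S 3 * C 4 * S 5 * S 7 * C 8 + C 6 * C 1 * S 2 * C 3 * S 4 * C 5 * C 7 * S 8"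
  "twin 8 S C 7 = S 7 * C 1 * S 2 * C 3 * S 4 * C 5 * S 6 * S 8 + C 7 * S 1 * C 2 * S 3 * C 4 * S 5 * C 6 * C 8"
  "twin 8 S C 8 = S 8 * S 1 * C 2 * S 3 * C 4 * S 5 * C 6 * S 7 + C 8 * C 1 * S 2 * C 3 * S 4 * C 5 * S 6 * C 7"
  unfolding twin_def interval_8 by (simp_all add: insert_Diff_if del: One_nat_def)

text \<open>
  At this point the fourth component is the only nonzero one: each of the other components has a
  vanishing factor among the sites 3 to 6 in both products, whatever the values at 1 and 2.
\<close>

lemma twin_jacobian_6_asymmetric:
  assumes "S 1 = h" "C 1 = h" "S 2 = h" "C 2 = h" "S 3 = 0" "C 3 = 1" "S 4 = 0" "C 4 = 1" "S 5 = 0" "C 5 = 1"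
    "S 6 = 1" "C 6 = (0::real)"
  shows "twin_jacobian 6 S C 1 2 = 2 * h ^ 4" "twin_jacobian 6 S C 2 1 = - 2 * h ^ 4"
  unfolding twin_jacobian_def interval_6 Let_def
  by (simp_all add: twin_6 assms power4_eq_xxxx[of h] del: One_nat_def)

lemma twin_jacobian_8_asymmetric:
  assumes "S 1 = h" "C 1 = h" "S 2 = h" "C 2 = h" "S 3 = 0" "C 3 = 1" "S 4 = 0" "C 4 = 1" "S 5 = 0" "C 5 = 1"
    "S 6 = 1" "C 6 = (0::real)" "S 7 = 0" "C 7 = 1" "S 8 = 1" "C 8 = (0::real)"
  shows "twin_jacobian 8 S C 1 2 = 2 * h ^ 4" "twin_jacobian 8 S C 2 1 = - 2 * h ^ 4"
  unfolding twin_jacobian_def interval_8 Let_def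
  by (simp_all add: twin_8 assms power4_eq_xxxx[of h] del: One_nat_def)

text \<open>
  Both sides are quadratic forms in each pair \<open>(S u, C u)\<close>, and they have the same coefficients.
\<close>

lemma twin_jacobian_4_symmetric:
  fixes S C :: "nat \<Rightarrow> real"
  shows "twin_jacobian 4 S C 1 2 = twin_jacobian 4 S C 2 1"
    and "twin_jacobian 4 S C 1 3 = twin_jacobian 4 S C 3 1"
    and "twin_jacobian 4 S C 1 4 = twin_jacobian 4 S C 4 1"
    and "twin_jacobian 4 S C 2 3 = twin_jacobian 4 S C 3 2"
    and "twin_jacobian 4 S C 2 4 = twin_jacobian 4 S C 4 2"
    and "twin_jacobian 4 S C 3 4 = twin_jacobian 4 S C 4 3"
  unfolding twin_jacobian_def interval_4 Let_def
  by (simp_all add: twin_4 algebra_simps del: One_nat_def)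

section \<open>Three equally spaced phases\<close>

lemma interval_3: "{1..3::nat} = {1, 2, 3}" by auto

lemma advance_commute: "advance j (advance k y) = advance k (advance j y)"
  by (auto simp: advance_def)

text \<open>
  In general \<open>\<Sum>j. v j * \<partial>j (v i)\<close> is \<open>\<partial>i (\<bar>v\<bar>\<^sup>2 / 2)\<close> plus \<open>\<Sum>j. v j * (\<partial>j (v i) - \<partial>i (v j))\<close>, which is a
  component of the cross product of the curl with \<open>v\<close>. It vanishes if the curl is a multiple of \<open>v\<close>,
  and the Hessian of \<open>\<bar>v\<bar>\<^sup>2 / 2\<close> is symmetric.
\<close>

lemma beltrami_jacobian_symmetric:
  assumes curl: "\<And>y. vfield 3 e (advance 2 y) 1 - vfield 3 e (advance 1 y) 2 = c * vfield 3 e y 3"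
    "\<And>y. vfield 3 e (advance 3 y) 2 - vfield 3 e (advance 2 y) 3 = c * vfield 3 e y 1"
    "\<And>y. vfield 3 e (advance 1 y) 3 - vfield 3 e (advance 3 y) 1 = c * vfield 3 e y 2"
    and ik: "i \<in> {1..3}" "k \<in> {1..3}"
  shows "convection_jacobian 3 e y i k = convection_jacobian 3 e y k i"
proof -
  have sym: "convection_jacobian 3 e y i k = (\<Sum>j = 1..3. vfield 3 e (advance k y) j * vfield 3 e (advance i y) j
      + vfield 3 e y j * vfield 3 e (advance i (advance k y)) j)" if "i \<in> {1, 2, 3}" "k \<in> {1, 2, 3}" for i k
  proof -
    have 12: "vfield 3 e (advance 2 y) 1 = vfield 3 e (advance 1 y) 2 + c * vfield 3 e y 3"
      and 23: "vfield 3 e (advance 3 y) 2 = vfield 3 e (advance 2 y) 3 + c * vfield 3 e y 1"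
      and 31: "vfield 3 e (advance 1 y) 3 = vfield 3 e (advance 3 y) 1 + c * vfield 3 e y 2" for y
      using curl(1)[of y] curl(2)[of y] curl(3)[of y] by linarith+
    from that(1) consider "i = 1" | "i = 2" | "i = 3" by blast
    then show ?thesis
    proof cases
      case 1
      show ?thesis unfolding 1 convection_jacobian_def interval_3
        using 12[of y] 12[of "advance k y"] 31[of y] 31[of "advance k y"] by (simp add: algebra_simps)
    next
      case 2
      show ?thesis unfolding 2 convection_jacobian_def interval_3
        using 12[of y] 12[of "advance k y"] 23[of y] 23[of "advance k y"] by (simp add: algebra_simps)
    next
      case 3
      show ?thesis unfolding 3 convection_jacobian_def interval_3
        using 23[of y] 23[of "advance k y"] 31[of y] 31[of "advance k y"] by (simp add: algebra_simps)
    qed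
  qed
  have "i \<in> {1, 2, 3}" "k \<in> {1, 2, 3}" using ik by auto
  then show ?thesis 
    unfolding sym[OF \<open>i \<in> {1, 2, 3}\<close> \<open>k \<in> {1, 2, 3}\<close>] sym[OF \<open>k \<in> {1, 2, 3}\<close> \<open>i \<in> {1, 2, 3}\<close>]
    by (simp add: advance_commute[of i k] mult.commute)
qed

lemma three_phase_curl:
  assumes per: "\<And>m. e (m + 3) = e m" and e: "e 0 = 0" "cos (e 1) = - 1 / 2" "sin (e 1) = r / 2"
    "cos (e 2) = - 1 / 2" "sin (e 2) = - r / 2" and r: "r\<^sup>2 = 3"
  shows "vfield 3 e (advance 2 y) 1 - vfield 3 e (advance 1 y) 2 = - r * vfield 3 e y 3"
    "vfield 3 e (advance 3 y) 2 - vfield 3 e (advance 2 y) 3 = - r * vfield 3 e y 1"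
    "vfield 3 e (advance 1 y) 3 - vfield 3 e (advance 3 y) 1 = - r * vfield 3 e y 2"
proof -
  have em: "e 3 = e 0" "e (-1) = e 2" "e (-2) = e 1"
    using per[of 0] per[of "-1"] per[of "-2"] by simp_all
  have V: "vfield 3 e y 1 = sin (y 1) * cos (y 2 + e 1) * cos (y 3 + e 2) - sin (y 1 + e 1) * cos (y 2 + e 2) * cos (y 3)"
    "vfield 3 e y 2 = sin (y 2) * cos (y 3 + e 1) * cos (y 1 + e 2) - sin (y 2 + e 1) * cos (y 3 + e 2) * cos (y 1)"
    "vfield 3 e y 3 = sin (y 3) * cos (y 1 + e 1) * cos (y 2 + e 2) - sin (y 3 + e 1) * cos (y 1 + e 2) * cos (y 2)" for y
    unfolding vfield_def wave_def interval_3 by (simp_all add: insert_Diff_if em e(1) del: One_nat_def)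
  have rr: "r * r = 3" "r * (r * x) = 3 * x" for x
    using r by (simp_all add: power2_eq_square flip: mult.assoc)
  have q: "sin (x + pi / 2) = cos x" "cos (x + pi / 2) = - sin x" for x :: real
    by (simp_all add: sin_add cos_add)
  show "vfield 3 e (advance 2 y) 1 - vfield 3 e (advance 1 y) 2 = - r * vfield 3 e y 3"
    "vfield 3 e (advance 3 y) 2 - vfield 3 e (advance 2 y) 3 = - r * vfield 3 e y 1"
    "vfield 3 e (advance 1 y) 3 - vfield 3 e (advance 3 y) 1 = - r * vfield 3 e y 2"
    unfolding V advance_def
    by (simp_all add: q sin_add cos_add e del: One_nat_def) (simp_all add: field_simps rr)
qed

section \<open>The main result\<close>

lemma three_phase_solution:
  assumes "\<alpha> > 0" "vr > 0"
  shows "\<exists>\<xi>. \<not> vel_vanishes 3 \<alpha> vr \<xi> \<and> pressure_integrable 3 \<alpha> vr \<xi>"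
proof -
  \<comment> \<open>the third phase is \<open>- 2 * pi / 3\<close>, raised by \<open>pi / 2\<close> since the factor at offset 2 is a sine\<close>
  define \<xi> :: "nat \<Rightarrow> real" where "\<xi> = (\<lambda>k. if k = 2 then 2 * pi / 3 else if k = 3 then - pi / 6 else 0)"
  let ?e = "phase 3 \<xi>"
  have e: "?e 0 = 0" "?e 1 = 2 * pi / 3" "?e 2 = - (2 * pi / 3)"
    by (simp_all add: phase_def \<xi>_def)
  have trig: "cos (?e 1) = - 1 / 2" "sin (?e 1) = sqrt 3 / 2" "cos (?e 2) = - 1 / 2" "sin (?e 2) = - sqrt 3 / 2"
    unfolding e by (simp_all add: cos_120 sin_120)
  have per: "?e (m + 3) = ?e m" for m using phase_period[of 3 \<xi> m] by simp
  have "pressure_integrable 3 \<alpha> vr \<xi>"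
    using pressure_integrable_iff[of 3 \<alpha> vr \<xi>] assms
      beltrami_jacobian_symmetric[OF three_phase_curl[OF per e(1) trig]] by auto
  moreover have "\<not> vel_vanishes 3 \<alpha> vr \<xi>"
  proof -
    let ?y = "\<lambda>u::nat. if u = 2 then 0 else pi / 2 :: real"
    have "vfield 3 ?e ?y 1 \<noteq> 0"
      using per[of 0]
      by (simp add: vfield_def wave_def interval_3 insert_Diff_if e cos_120 sin_120 cos_add sin_add del: One_nat_def)
    then show ?thesis using vel_vanishes_iff[of 3 \<alpha> vr \<xi>] assms by force
  qed
  ultimately show ?thesis by blast
qed

lemma four_phase_solution:
  assumes "\<alpha> > 0" "vr > 0"
  shows "\<exists>\<xi>. \<not> vel_vanishes 4 \<alpha> vr \<xi> \<and> pressure_integrable 4 \<alpha> vr \<xi>"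
proof (intro exI conjI)
  show "pressure_integrable 4 \<alpha> vr sym_phase"
  proof -
    have "convection_jacobian 4 (phase 4 sym_phase) y i j = convection_jacobian 4 (phase 4 sym_phase) y j i"
      if "i \<in> {1, 2, 3, 4}" "j \<in> {1, 2, 3, 4}" for i j y
      using that twin_jacobian_4_symmetric by (auto simp: convection_jacobian_sym simp del: One_nat_def)
    then show ?thesis
      using pressure_integrable_iff[of 4 \<alpha> vr sym_phase] assms unfolding interval_4 by simp
  qed
  \<comment> \<open>a point where the first product of the first component is 1 and the second is 0\<close>
  let ?y = "\<lambda>u::nat. if u = 3 then pi / 4 else pi / 4 + pi / 2 :: real"
  have "vfield 4 (phase 4 sym_phase) ?y 1 \<noteq> 0"
    by (simp add: vfield_sym twin_4 del: One_nat_def)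
  then show "\<not> vel_vanishes 4 \<alpha> vr sym_phase"
    using vel_vanishes_iff[of 4 \<alpha> vr sym_phase] assms by force
qed

lemma sym_phase_not_integrable:
  assumes "n = 6 \<or> n = 8" "\<alpha> > 0" "vr > 0"
  shows "\<not> pressure_integrable n \<alpha> vr sym_phase"
proof -
  \<comment> \<open>coordinates measured from \<open>pi / 4\<close>: sines and cosines are 0 or 1 except at the sites 1 and 2\<close>
  define w :: "nat \<Rightarrow> real" where "w = (\<lambda>u. if u \<le> 2 then pi / 4 else if u \<in> {6, 8} then pi / 2 else 0)"
  let ?S = "\<lambda>u. sin (w u)" and ?C = "\<lambda>u. cos (w u)"
  define h :: real where "h = sqrt 2 / 2"
  have h: "h \<noteq> 0" by (simp add: h_def)
  have "twin_jacobian n ?S ?C 1 2 = 2 * h ^ 4 \<and> twin_jacobian n ?S ?C 2 1 = - 2 * h ^ 4"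
    using assms(1) twin_jacobian_6_asymmetric[of ?S h ?C] twin_jacobian_8_asymmetric[of ?S h ?C]
    by (auto simp: w_def h_def sin_45 cos_45 simp del: One_nat_def)
  then have "twin_jacobian n ?S ?C 1 2 \<noteq> twin_jacobian n ?S ?C 2 1" using h by auto
  then have "convection_jacobian n (phase n sym_phase) (\<lambda>u. pi / 4 + w u) 1 2
      \<noteq> convection_jacobian n (phase n sym_phase) (\<lambda>u. pi / 4 + w u) 2 1"
    using assms(1) convection_jacobian_sym[of n "\<lambda>u. pi / 4 + w u"] by auto
  then show ?thesis
    using pressure_integrable_iff[of n \<alpha> vr sym_phase] assms by force
qed

theorem theorem9p1:
  fixes \<alpha> vr :: real
  assumes "\<alpha> > 0" and "vr > 0"
  shows "(\<forall>n\<in>{3, 4}. \<exists>\<xi>. \<not> vel_vanishes n \<alpha> vr \<xi> \<and> pressure_integrable n \<alpha> vr \<xi>)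
       \<and> (\<forall>n\<in>{5, 7}. \<forall>\<xi>. reduction_condition n \<alpha> vr \<xi> \<longrightarrow> vel_vanishes n \<alpha> vr \<xi>)
       \<and> (\<forall>n\<in>{6, 8}. reduction_condition n \<alpha> vr sym_phase
                     \<and> \<not> pressure_integrable n \<alpha> vr sym_phase)"
  using assms three_phase_solution[of \<alpha> vr] four_phase_solution[of \<alpha> vr] vanishing_of_reduction[of _ \<alpha> vr]
    sym_phase_reduction[of _ \<alpha> vr] sym_phase_not_integrable[of _ \<alpha> vr]
  by auto

end
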